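(* Let $\mathcal{H}_1,\mathcal{H}_2$ be complex separable Hilbert spaces, let $A:\operatorname{dom}(A)\subseteq\mathcal{H}_1\to\mathcal{H}_2$ be a densely defined, closed, linear operator with $\ker(A)=\{0\}$ and $\inf(\sigma(A^*A))=0$, and let $R$ be a densely defined, closable operator in $\mathcal{H}_1$ with $\operatorname{dom}(R)\cap\operatorname{dom}(R^* )\supseteq\operatorname{dom}(A)$. Then $$Q_{|A|,R}=U_{\widetilde{|A|}}\,i\,G_{A,R}\,U_{\widetilde{|A|}}^{-1}$$ (equality including domains). In particular, the operator $G_{A,R}$ is densely defined and closed in $\mathcal{H}_A\oplus\mathcal{H}_1$. If in addition $R$ is accretive, then $i\lambda\in\rho(M(\cdot))$ for some $\lambda>0$, and also $-G_{|A|,R}$ is accretive and $G_{|A|,R}$ generates a (strongly continuous) contraction semigroup $\exp(G_{|A|,R}\,t)$, $t\geq0$, in $\mathcal{H}_A\oplus\mathcal{H}_1$.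
   Context: $|A|=(A^*A)^{1/2}$, with $\operatorname{dom}(|A|)=\operatorname{dom}(A)$ and $\||A|f\|_{\mathcal{H}_1}=\|Af\|_{\mathcal{H}_2}$. Under the hypotheses on $A$: - $\mathcal{H}_A$ is the Hilbert space completion of $\operatorname{dom}(A)$ with respect to the scalar product $(f,g)_A=(Af,Ag)_{\mathcal{H}_2}$; $\operatorname{dom}(A)$ is regarded as a dense subspace of $\mathcal{H}_A$. - $\mathcal{K}_A=\overline{\operatorname{ran}(A)}\subseteq\mathcal{H}_2$. - $\widetilde A:\mathcal{H}_A\to\mathcal{K}_A$ is the unique unitary extension of $\operatorname{dom}(A)\ni f\mapsto Af$, and $\widetilde{|A|}:\mathcal{H}_A\to\mathcal{H}_1$ is the unique unitary extension of $\operatorname{dom}(A)\ni f\mapsto|A|f$. - $J_A:\mathcal{H}_1\supseteq\operatorname{dom}(A)\to\mathcal{H}_A$, $f\mapsto f$. - $U_{\widetilde{|A|}}=\begin{pmatrix}0&I_{\mathcal{H}_1}\\-i\widetilde{|A|}&0\end{pmatrix}:\mathcal{H}_A\oplus\mathcal{H}_1\to\mathcal{H}_1\oplus\mathcal{H}_1$, a unitary operator. - $G_{A,R}=\begin{pmatrix}0&J_A\\-A^*\widetilde A&-R\end{pmatrix}$ in $\mathcal{H}_A\oplus\mathcal{H}_1$ with $\operatorname{dom}(G_{A,R})=\operatorname{dom}(A^*\widetilde A)\oplus\operatorname{dom}(A)$, where $\operatorname{dom}(A^*\widetilde A)=\{f\in\mathcal{H}_A:\widetilde Af\in\operatorname{dom}(A^*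 )\}$. $G_{|A|,R}$ is the same operator with $A$ replaced by $|A|$ (so $\mathcal{H}_{|A|}=\mathcal{H}_A$, $J_{|A|}=J_A$); it coincides with $G_{A,R}$. - $Q_{|A|,R}=\begin{pmatrix}-iR&|A|\\|A|&0\end{pmatrix}$ in $\mathcal{H}_1\oplus\mathcal{H}_1$ with $\operatorname{dom}(Q_{|A|,R})=\operatorname{dom}(|A|)\oplus\operatorname{dom}(|A|)$. - $M(z)=|A|^2-izR-z^2I_{\mathcal{H}_1}$, $\operatorname{dom}(M(z))=\operatorname{dom}(|A|^2)$, $z\in\mathbb{C}$, and $\rho(M(\cdot))=\{z\in\mathbb{C}\,|\,0\in\rho(M(z))\}$. An operator $T$ in a Hilbert space $\mathcal{H}$ is accretive if $\operatorname{Re}((f,Tf)_{\mathcal{H}})\geq0$ for all $f\in\operatorname{dom}(T)$. *)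

theory Defs
  imports "HOL-Analysis.Analysis"
begin

section \<open>Complex Hilbert spaces\<close>

text \<open>The real structure (topology, norm, real scalars) is the one of \<^class>\<open>real_inner\<close>; the complex
  inner product is linear in the second factor, and its real part is the real inner product, so
  that \<open>norm x = sqrt (Re (cinner x x))\<close>.\<close>

class chilbert_space = real_inner + complete_space +
  fixes scaleC :: "complex \<Rightarrow> 'a \<Rightarrow> 'a" (infixr "*\<^sub>C" 75)
    and cinner :: "'a \<Rightarrow> 'a \<Rightarrow> complex"
  assumes scaleC_add_right: "c *\<^sub>C (x + y) = c *\<^sub>C x + c *\<^sub>C y"
    and scaleC_add_left: "(c + d) *\<^sub>C x = c *\<^sub>C x + d *\<^sub>C x"
    and scaleC_scaleC: "c *\<^sub>C (d *\<^sub>C x) = (c * d) *\<^sub>C x"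
    and scaleC_of_real: "complex_of_real r *\<^sub>C x = r *\<^sub>R x"
    and cinner_commute: "cinner x y = cnj (cinner y x)"
    and cinner_add_right: "cinner x (y + z) = cinner x y + cinner x z"
    and cinner_scaleC_right: "cinner x (c *\<^sub>C y) = c * cinner x y"
    and Re_cinner: "Re (cinner x y) = inner x y"

text \<open>The orthogonal sum of two Hilbert spaces is the product type.\<close>

instantiation prod :: (chilbert_space, chilbert_space) chilbert_space
begin

definition scaleC_prod_def: "c *\<^sub>C p = (c *\<^sub>C fst p, c *\<^sub>C snd p)"

definition cinner_prod_def: "cinner p q = cinner (fst p) (fst q) + cinner (snd p) (snd q)"

instance
proof
  fix c d :: complex and r :: real and x y z :: "'a \<times> 'b"
  show "c *\<^sub>C (x + y) = c *\<^sub>C x + c *\<^sub>C y"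
    by (simp add: scaleC_prod_def scaleC_add_right)
  show "(c + d) *\<^sub>C x = c *\<^sub>C x + d *\<^sub>C x"
    by (simp add: scaleC_prod_def scaleC_add_left)
  show "c *\<^sub>C (d *\<^sub>C x) = (c * d) *\<^sub>C x"
    by (simp add: scaleC_prod_def scaleC_scaleC)
  show "complex_of_real r *\<^sub>C x = r *\<^sub>R x"
    by (simp add: scaleC_prod_def scaleC_of_real scaleR_prod_def)
  show "cinner x y = cnj (cinner y x)"
    unfolding cinner_prod_def
    by (metis cinner_commute complex_cnj_add)
  show "cinner x (y + z) = cinner x y + cinner x z"
    by (simp add: cinner_prod_def cinner_add_right)
  show "cinner x (c *\<^sub>C y) = c * cinner x y"
    by (simp add: cinner_prod_def scaleC_prod_def cinner_scaleC_right distrib_left)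
  show "Re (cinner x y) = inner x y"
    by (simp add: cinner_prod_def inner_prod_def Re_cinner)
qed

end

definition clinear_map :: "('a::chilbert_space \<Rightarrow> 'b::chilbert_space) \<Rightarrow> bool" where
  "clinear_map T \<longleftrightarrow> (\<forall>x y. T (x + y) = T x + T y) \<and> (\<forall>c x. T (c *\<^sub>C x) = c *\<^sub>C T x)"

definition unitary_onto :: "('a::chilbert_space \<Rightarrow> 'b::chilbert_space) \<Rightarrow> 'b set \<Rightarrow> bool" where
  "unitary_onto T K \<longleftrightarrow>
     clinear_map T \<and> (\<forall>x y. cinner (T x) (T y) = cinner x y) \<and> range T = K"

section \<open>Unbounded operators\<close>

text \<open>An operator with domain \<open>D\<close> is a partial function with \<open>dom T = D\<close>; equality of partial
  functions is equality of operators including domains, \<^const>\<open>map_comp\<close> is the product of operators on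
  its natural domain, and \<open>S \<subseteq>\<^sub>m T\<close> says that \<open>T\<close> extends \<open>S\<close>.\<close>

abbreviation app :: "('a \<rightharpoonup> 'b) \<Rightarrow> 'a \<Rightarrow> 'b" (infixl "\<cdot>" 90) where
  "T \<cdot> f \<equiv> the (T f)"

definition linear_op :: "('a::chilbert_space \<rightharpoonup> 'b::chilbert_space) \<Rightarrow> bool" where
  "linear_op T \<longleftrightarrow>
     0 \<in> dom T \<and>
     (\<forall>f\<in>dom T. \<forall>g\<in>dom T. f + g \<in> dom T \<and> T \<cdot> (f + g) = T \<cdot> f + T \<cdot> g) \<and>
     (\<forall>c. \<forall>f\<in>dom T. c *\<^sub>C f \<in> dom T \<and> T \<cdot> (c *\<^sub>C f) = c *\<^sub>C (T \<cdot> f))"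

definition densely_defined :: "('a::chilbert_space \<rightharpoonup> 'b::chilbert_space) \<Rightarrow> bool" where
  "densely_defined T \<longleftrightarrow> closure (dom T) = UNIV"

definition closed_op :: "('a::chilbert_space \<rightharpoonup> 'b::chilbert_space) \<Rightarrow> bool" where
  "closed_op T \<longleftrightarrow> closed (Map.graph T)"

definition closable_op :: "('a::chilbert_space \<rightharpoonup> 'b::chilbert_space) \<Rightarrow> bool" where
  "closable_op T \<longleftrightarrow> (\<exists>S. linear_op S \<and> closed_op S \<and> T \<subseteq>\<^sub>m S)"

definition ker_op :: "('a::chilbert_space \<rightharpoonup> 'b::chilbert_space) \<Rightarrow> 'a set" where
  "ker_op T = {f \<in> dom T. T \<cdot> f = 0}"

definition scale_op ::
    "complex \<Rightarrow> ('a::chilbert_space \<rightharpoonup> 'b::chilbert_space) \<Rightarrow> ('a \<rightharpoonup> 'b)" where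
  "scale_op c T = (\<lambda>f. if f \<in> dom T then Some (c *\<^sub>C (T \<cdot> f)) else None)"

text \<open>The adjoint is meaningful for densely defined operators only, since density of \<open>dom T\<close> makes
  \<open>h\<close> unique.\<close>

definition adj :: "('a::chilbert_space \<rightharpoonup> 'b::chilbert_space) \<Rightarrow> ('b \<rightharpoonup> 'a)" where
  "adj T = (\<lambda>g. if \<exists>h. \<forall>f\<in>dom T. cinner g (T \<cdot> f) = cinner h f
                then Some (THE h. \<forall>f\<in>dom T. cinner g (T \<cdot> f) = cinner h f) else None)"

definition selfadjoint_op :: "('a::chilbert_space \<rightharpoonup> 'a) \<Rightarrow> bool" where
  "selfadjoint_op T \<longleftrightarrow> linear_op T \<and> densely_defined T \<and> adj T = T"

definition accretive :: "('a::chilbert_space \<rightharpoonup> 'a) \<Rightarrow> bool" where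
  "accretive T \<longleftrightarrow> (\<forall>f\<in>dom T. 0 \<le> Re (cinner f (T \<cdot> f)))"

text \<open>\<open>(f, T f)\<close> is automatically real when \<open>T\<close> is self-adjoint.\<close>

definition nonneg_selfadjoint_op :: "('a::chilbert_space \<rightharpoonup> 'a) \<Rightarrow> bool" where
  "nonneg_selfadjoint_op T \<longleftrightarrow>
     selfadjoint_op T \<and> (\<forall>f\<in>dom T. 0 \<le> Re (cinner f (T \<cdot> f)))"

text \<open>In place of a functional calculus: \<open>T\<^sup>1\<^sup>/\<^sup>2\<close> is the unique nonnegative self-adjoint operator whose
  square, on its natural domain, is the nonnegative self-adjoint operator \<open>T\<close>.\<close>

definition sqrt_op :: "('a::chilbert_space \<rightharpoonup> 'a) \<Rightarrow> ('a \<rightharpoonup> 'a)" where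
  "sqrt_op T = (THE S. nonneg_selfadjoint_op S \<and> S \<circ>\<^sub>m S = T)"

definition abs_op :: "('a::chilbert_space \<rightharpoonup> 'b::chilbert_space) \<Rightarrow> ('a \<rightharpoonup> 'a)" where
  "abs_op A = sqrt_op (adj A \<circ>\<^sub>m A)"

text \<open>\<open>B\<close> is the everywhere defined bounded inverse of \<open>T - z\<close>.\<close>

definition resolvent_set :: "('a::chilbert_space \<rightharpoonup> 'a) \<Rightarrow> complex set" where
  "resolvent_set T = {z. \<exists>B. clinear_map B \<and> (\<exists>C. \<forall>g. norm (B g) \<le> C * norm g) \<and>
     (\<forall>g. B g \<in> dom T \<and> T \<cdot> (B g) - z *\<^sub>C B g = g) \<and>
     (\<forall>f\<in>dom T. B (T \<cdot> f - z *\<^sub>C f) = f)}"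

definition spectrum :: "('a::chilbert_space \<rightharpoonup> 'a) \<Rightarrow> complex set" where
  "spectrum T = - resolvent_set T"

section \<open>Contraction semigroups\<close>

definition contraction_semigroup :: "(real \<Rightarrow> 'a::chilbert_space \<Rightarrow> 'a) \<Rightarrow> bool" where
  "contraction_semigroup S \<longleftrightarrow>
     (\<forall>t\<ge>0. clinear_map (S t) \<and> (\<forall>f. norm (S t f) \<le> norm f)) \<and>
     (\<forall>f. S 0 f = f) \<and>
     (\<forall>s\<ge>0. \<forall>t\<ge>0. \<forall>f. S (s + t) f = S s (S t f)) \<and>
     (\<forall>f. continuous_on {0..} (\<lambda>t. S t f))"

definition generator :: "(real \<Rightarrow> 'a::chilbert_space \<Rightarrow> 'a) \<Rightarrow> ('a \<rightharpoonup> 'a)" where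
  "generator S = (\<lambda>f. if \<exists>l. ((\<lambda>t. (S t f - f) /\<^sub>R t) \<longlongrightarrow> l) (at_right 0)
                      then Some (Lim (at_right 0) (\<lambda>t. (S t f - f) /\<^sub>R t)) else None)"

definition generates_contraction_semigroup :: "('a::chilbert_space \<rightharpoonup> 'a) \<Rightarrow> bool" where
  "generates_contraction_semigroup G \<longleftrightarrow> (\<exists>S. contraction_semigroup S \<and> generator S = G)"

section \<open>The operators associated with \<open>A\<close> and \<open>R\<close>\<close>

text \<open>The type \<open>'h\<close> together with \<open>J : dom A \<rightarrow> 'h\<close> (the operator \<open>J\<^sub>A\<close>) is a Hilbert space completion
  of \<open>dom A\<close> with respect to the scalar product \<open>(f, g)\<^sub>A = (A f, A g)\<close>; such a completion is unique
  up to a unique unitary map respecting the embeddings.\<close>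

definition is_completion ::
    "('a::chilbert_space \<rightharpoonup> 'b::chilbert_space) \<Rightarrow> ('a \<rightharpoonup> 'h::chilbert_space) \<Rightarrow> bool" where
  "is_completion A J \<longleftrightarrow>
     linear_op J \<and> dom J = dom A \<and>
     (\<forall>f\<in>dom A. \<forall>g\<in>dom A. cinner (J \<cdot> f) (J \<cdot> g) = cinner (A \<cdot> f) (A \<cdot> g)) \<and>
     closure (ran J) = UNIV"

text \<open>The unique unitary map from the completion onto \<open>K\<close> that extends \<open>f \<mapsto> B f\<close>. It is used with
  \<open>K\<close> the closure of \<open>ran A\<close> for \<open>B = A\<close>, and with \<open>K\<close> the whole space \<open>H\<^sub>1\<close> for \<open>B = |A|\<close>.\<close>

definition unitary_extension ::
    "('a::chilbert_space \<rightharpoonup> 'h::chilbert_space) \<Rightarrow> 'c::chilbert_space set \<Rightarrow> ('a \<rightharpoonup> 'c) \<Rightarrow> ('h \<Rightarrow> 'c)"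
where
  "unitary_extension J K B =
     (THE T. unitary_onto T K \<and> (\<forall>f\<in>dom B. T (J \<cdot> f) = B \<cdot> f))"

definition tilde_op ::
    "('a::chilbert_space \<rightharpoonup> 'h::chilbert_space) \<Rightarrow> ('a \<rightharpoonup> 'b::chilbert_space) \<Rightarrow> ('h \<Rightarrow> 'b)" where
  "tilde_op J A = unitary_extension J (closure (ran A)) A"

definition tilde_abs ::
    "('a::chilbert_space \<rightharpoonup> 'h::chilbert_space) \<Rightarrow> ('a \<rightharpoonup> 'b::chilbert_space) \<Rightarrow> ('h \<Rightarrow> 'a)" where
  "tilde_abs J A = unitary_extension J UNIV (abs_op A)"

definition U_op ::
    "('a::chilbert_space \<rightharpoonup> 'h::chilbert_space) \<Rightarrow> ('a \<rightharpoonup> 'b::chilbert_space) \<Rightarrow>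
     ('h \<times> 'a \<Rightarrow> 'a \<times> 'a)" where
  "U_op J A = (\<lambda>(f, g). (g, (- \<i>) *\<^sub>C tilde_abs J A f))"

definition G_op ::
    "('a::chilbert_space \<rightharpoonup> 'h::chilbert_space) \<Rightarrow> ('a \<rightharpoonup> 'b::chilbert_space) \<Rightarrow> ('a \<rightharpoonup> 'a) \<Rightarrow>
     ('h \<times> 'a \<rightharpoonup> 'h \<times> 'a)" where
  "G_op J A R = (\<lambda>(f, g).
     if tilde_op J A f \<in> dom (adj A) \<and> g \<in> dom A
     then Some (J \<cdot> g, - (adj A \<cdot> (tilde_op J A f)) - R \<cdot> g)
     else None)"

definition Q_op ::
    "('a::chilbert_space \<rightharpoonup> 'b::chilbert_space) \<Rightarrow> ('a \<rightharpoonup> 'a) \<Rightarrow> ('a \<times> 'a \<rightharpoonup> 'a \<times> 'a)" where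
  "Q_op A R = (\<lambda>(f, g).
     if f \<in> dom (abs_op A) \<and> g \<in> dom (abs_op A)
     then Some ((- \<i>) *\<^sub>C (R \<cdot> f) + abs_op A \<cdot> g, abs_op A \<cdot> f)
     else None)"

definition M_op ::
    "('a::chilbert_space \<rightharpoonup> 'b::chilbert_space) \<Rightarrow> ('a \<rightharpoonup> 'a) \<Rightarrow> complex \<Rightarrow> ('a \<rightharpoonup> 'a)" where
  "M_op A R z = (\<lambda>f.
     if f \<in> dom (abs_op A \<circ>\<^sub>m abs_op A)
     then Some ((abs_op A \<circ>\<^sub>m abs_op A) \<cdot> f - (\<i> * z) *\<^sub>C (R \<cdot> f) - z\<^sup>2 *\<^sub>C f)
     else None)"

definition rho_M ::
    "('a::chilbert_space \<rightharpoonup> 'b::chilbert_space) \<Rightarrow> ('a \<rightharpoonup> 'a) \<Rightarrow> complex set" where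
  "rho_M A R = {z. 0 \<in> resolvent_set (M_op A R z)}"

end

theory Submission
  imports Defs
begin

text \<open>
  Put \<open>B = (1 + A\<^sup>* A)\<^sup>-\<^sup>1\<close>, which exists by projecting onto the graph of \<open>A\<close>. The bounded square
  roots \<open>E = B\<^sup>1\<^sup>/\<^sup>2\<close> and \<open>F = (1 - B)\<^sup>1\<^sup>/\<^sup>2\<close> give \<open>|A|\<close> as the operator with graph \<open>{(E x, F x) | x}\<close>; it is
  the only nonnegative square root because \<open>|A| B\<close> is determined by its square \<open>B (1 - B)\<close> and
  \<open>dom (A\<^sup>* A)\<close> is a core.

  Since \<open>A\<close> and \<open>|A|\<close> induce the same form, their unitary extensions \<open>V\<close> and \<open>W\<close> satisfy
  \<open>A\<^sup>* V = |A| W\<close>, and conjugation by \<open>U\<close> is a direct computation. If \<open>R\<close> is accretive, then \<open>Re (z, G z) = - Re (p, R p) \<le> 0\<close> for \<open>z = (x, p)\<close>;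
  hence \<open>1 - h G\<close> has closed range, and the range is dense because a vector \<open>(y\<^sub>1, y\<^sub>2)\<close> orthogonal to it
  satisfies \<open>y\<^sub>2 \<in> dom |A|\<close>, so it may be tested against \<open>(0, y\<^sub>2)\<close>. The semigroup is the limit of the
  implicit Euler scheme \<open>(1 - h G)\<^sup>-\<^sup>n\<close> along \<open>h = 2\<^sup>-\<^sup>k\<close>, \<open>n = \<lfloor>t / h\<rfloor>\<close>, which needs neither integrals nor
  exponentials.
\<close>

section \<open>Projections and bounded square roots\<close>

text \<open>\<open>abs_op\<close> and \<open>unitary_extension\<close> are definite descriptions, so
  nothing is known about \<open>|A|\<close> or the two tilde maps before existence and uniqueness
  are both proved. Uniqueness of the root is the delicate half: the classical argument compares two
  commuting bounded roots, but the roots of \<open>A* A\<close> are unbounded. The comparison is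
  therefore made between the bounded operators \<open>S (1 + S^2)^-1\<close>. They commute because E
  and F are obtained from limits of polynomials in B and so commute with every bounded operator that
  commutes with B. The complex structure stays in the background. The real inner product already
  determines adjoints, dissipativity and contractivity, and complex homogeneity returns as
  commutation with the bounded operator "multiply by c". Dyadic step sizes are used because
  \<open>(1 - h G / 2)^2\<close> and \<open>1 - h G\<close> differ only by
  \<open>(h^2 / 4) G^2\<close>: one step is compared with two half steps, and the differences
  between consecutive levels are geometric in k.\<close>

lemma quadratic_nonneg_imp_zero:
  fixes a b :: real
  assumes "\<And>t. 0 \<le> t * a + t\<^sup>2 * b"
  shows "a = 0"
proof (rule ccontr)
  assume "a \<noteq> 0"
  \<comment> \<open>Any c > 0 above b works: at t = -a/c the quadratic equals (a^2/c^2)(b - c),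
    which is negative.\<close>
  define c where "c = \<bar>b\<bar> + 1"
  have c: "c > 0" "b < c" by (auto simp: c_def)
  have "0 \<le> (- a / c) * a + (- a / c)\<^sup>2 * b" using assms by blast
  also have "\<dots> = (a\<^sup>2 / c\<^sup>2) * (b - c)"
    using c by (simp add: field_simps power2_eq_square)
  also have "\<dots> < 0" using c \<open>a \<noteq> 0\<close> by (intro mult_pos_neg) auto
  finally show False by simp
qed

text \<open>A minimising sequence for the distance converges, and minimality along each line through
  the limit kills the inner product. Only the real structure enters, so graphs in a product space
  are covered directly.\<close>

lemma orthogonal_projection:
  fixes V :: "'a::{real_inner,complete_space} set"
  assumes V: "subspace V" and cl: "closed V"
  obtains v where "v \<in> V" "\<And>w. w \<in> V \<Longrightarrow> inner (x - v) w = 0"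
proof -
  define d where "d = (INF v\<in>V. (norm (x - v))\<^sup>2)"
  have ne: "V \<noteq> {}" using subspace_0[OF V] by auto
  have bb: "bdd_below ((\<lambda>v. (norm (x - v))\<^sup>2) ` V)" by (rule bdd_belowI2[of _ 0]) simp
  have d_le: "d \<le> (norm (x - v))\<^sup>2" if "v \<in> V" for v
    unfolding d_def using bb that by (rule cINF_lower)
  have "\<exists>v\<in>V. (norm (x - v))\<^sup>2 < d + 1 / real (Suc n)" for n
    using cInf_lessD[of "(\<lambda>v. (norm (x - v))\<^sup>2) ` V" "d + 1 / real (Suc n)"] ne
    by (auto simp: d_def)
  then obtain v where v: "\<And>n. v n \<in> V" "\<And>n. (norm (x - v n))\<^sup>2 < d + 1 / real (Suc n)"
    by metis
  \<comment> \<open>The midpoint of two near-minimisers lies in V, so its distance to x is not below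
    the infimum; the parallelogram law then bounds their difference.\<close>
  have dist: "(norm (v n - v m))\<^sup>2 \<le> 2 * (1 / real (Suc n)) + 2 * (1 / real (Suc m))" for n m
  proof -
    have "(1/2) *\<^sub>R (v n + v m) \<in> V" using V v(1) by (simp add: subspace_add subspace_scale)
    then have "d \<le> (norm (x - (1/2) *\<^sub>R (v n + v m)))\<^sup>2" by (rule d_le)
    moreover have "(norm (v n - v m))\<^sup>2 = 2 * (norm (x - v n))\<^sup>2 + 2 * (norm (x - v m))\<^sup>2
        - 4 * (norm (x - (1/2) *\<^sub>R (v n + v m)))\<^sup>2"
      by (simp add: power2_norm_eq_inner algebra_simps inner_commute)
    ultimately show ?thesis using v(2)[of n] v(2)[of m] by linarith
  qed
  have "Cauchy v"
  proof (rule metric_CauchyI)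
    fix e :: real assume "e > 0"
    obtain N where N: "4 / e\<^sup>2 < real (Suc N)"
      by (meson less_Suc_eq less_trans of_nat_less_iff reals_Archimedean2)
    have "dist (v m) (v n) < e" if "m \<ge> N" "n \<ge> N" for m n
    proof -
      have "1 / real (Suc m) \<le> 1 / real (Suc N)" "1 / real (Suc n) \<le> 1 / real (Suc N)"
        using that by (auto simp: frac_le)
      then have "(norm (v m - v n))\<^sup>2 \<le> 4 / real (Suc N)" using dist[of m n] by simp
      also have "\<dots> < e\<^sup>2" using N \<open>e > 0\<close> by (simp add: field_simps)
      finally show ?thesis using \<open>e > 0\<close> by (simp add: dist_norm power_less_imp_less_base)
    qed
    then show "\<exists>M. \<forall>m\<ge>M. \<forall>n\<ge>M. dist (v m) (v n) < e" by blast
  qed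
  then obtain u where u: "v \<longlonglongrightarrow> u" using Cauchy_convergent convergent_def by blast
  have uV: "u \<in> V" using closed_sequentially[OF cl _ u] v(1) by blast
  have "(\<lambda>n. d + 1 / real (Suc n)) \<longlonglongrightarrow> d + 0"
    by (intro tendsto_intros LIMSEQ_Suc[OF lim_1_over_n])
  moreover have "(\<lambda>n. (norm (x - v n))\<^sup>2) \<longlonglongrightarrow> (norm (x - u))\<^sup>2" by (intro tendsto_intros u)
  ultimately have du: "(norm (x - u))\<^sup>2 \<le> d"
    using v(2) by (intro LIMSEQ_le[where Y = "\<lambda>n. d + 1 / real (Suc n)"]) (auto intro: less_imp_le)
  have "inner (x - u) w = 0" if w: "w \<in> V" for w
  proof -
    have "0 \<le> t * (- 2 * inner (x - u) w) + t\<^sup>2 * inner w w" for t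
    proof -
      have "u + t *\<^sub>R w \<in> V" using V w uV by (simp add: subspace_add subspace_scale)
      then have "(norm (x - u))\<^sup>2 \<le> (norm (x - (u + t *\<^sub>R w)))\<^sup>2"
        by (rule order_trans[OF du d_le])
      then show ?thesis
        unfolding power2_norm_eq_inner by (simp add: algebra_simps inner_commute power2_eq_square)
    qed
    from quadratic_nonneg_imp_zero[OF this] show ?thesis by simp
  qed
  then show ?thesis using that uV by blast
qed

lemma subspace_closure:
  fixes V :: "'a::real_normed_vector set"
  assumes V: "subspace V"
  shows "subspace (closure V)"
proof (rule subspaceI)
  show "0 \<in> closure V" using subspace_0[OF V] closure_subset by blast
next
  fix x y assume "x \<in> closure V" "y \<in> closure V"
  then obtain f g where "\<And>n. f n \<in> V" "f \<longlonglongrightarrow> x" "\<And>n. g n \<in> V" "g \<longlonglongrightarrow> y"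
    unfolding closure_sequential by blast
  then show "x + y \<in> closure V"
    unfolding closure_sequential
    by (intro exI[of _ "\<lambda>n. f n + g n"]) (auto intro: tendsto_add subspace_add[OF V])
next
  fix c x assume "x \<in> closure V"
  then obtain f where "\<And>n. f n \<in> V" "f \<longlonglongrightarrow> x" unfolding closure_sequential by blast
  then show "c *\<^sub>R x \<in> closure V"
    unfolding closure_sequential
    by (intro exI[of _ "\<lambda>n. c *\<^sub>R f n"]) (auto intro: tendsto_scaleR subspace_scale[OF V])
qed

text \<open>The density of \<open>dom |A|\<close>, of \<open>ran |A|\<close>, of the first factor of
  \<open>dom G\<close> and of the range of 1 - h G is each reduced by this to the vanishing of an
  orthogonal vector.\<close>

lemma closure_eq_UNIV_if_no_orthogonal:
  fixes V :: "'a::{real_inner,complete_space} set"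
  assumes V: "subspace V" and orth: "\<And>y. (\<And>v. v \<in> V \<Longrightarrow> inner y v = 0) \<Longrightarrow> y = 0"
  shows "closure V = UNIV"
proof -
  have "x \<in> closure V" for x
  proof -
  obtain v where v: "v \<in> closure V" "\<And>w. w \<in> closure V \<Longrightarrow> inner (x - v) w = 0"
    using orthogonal_projection[OF subspace_closure[OF V] closed_closure] by blast
  then have "x - v = 0" using orth closure_subset by blast
    then show ?thesis using v by simp
  qed
  then show ?thesis by auto
qed

lemma orthogonal_dense_imp_zero:
  fixes y :: "'a::real_inner"
  assumes "closure V = UNIV" "\<And>v. v \<in> V \<Longrightarrow> inner y v = 0"
  shows "y = 0"
proof -
  obtain f where f: "\<And>n. f n \<in> V" "f \<longlonglongrightarrow> y"
    using assms(1) closure_sequential[of y V] by auto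
  have "(\<lambda>n. inner y (f n)) \<longlonglongrightarrow> inner y y" by (intro tendsto_intros f)
  moreover have "(\<lambda>n. inner y (f n)) = (\<lambda>n. 0)" using assms f by auto
  ultimately have "inner y y = 0" by (simp add: LIMSEQ_const_iff)
  then show ?thesis by simp
qed

text \<open>Fixed-point iteration for Y = 1 - (1 - X)^(1/2), started at 0; the nested call is the
  square of the current iterate. Each iterate is a polynomial in X with nonnegative coefficients and
  no constant term, so its norm is dominated by its value at the scalar X = 1.\<close>

fun sqrt_iter :: "('a::real_vector \<Rightarrow> 'a) \<Rightarrow> nat \<Rightarrow> 'a \<Rightarrow> 'a" where
  "sqrt_iter X 0 x = 0"
| "sqrt_iter X (Suc n) x = (X x + sqrt_iter X n (sqrt_iter X n x)) /\<^sub>R 2"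

text \<open>The majorant: the same iteration at X = 1.\<close>

fun scalar_iter :: "nat \<Rightarrow> real" where
  "scalar_iter 0 = 0"
| "scalar_iter (Suc n) = (1 + (scalar_iter n)\<^sup>2) / 2"

lemma scalar_iter_bounds: "0 \<le> scalar_iter n \<and> scalar_iter n \<le> 1"
proof (induction n)
  case (Suc n)
  then have "(scalar_iter n)\<^sup>2 \<le> 1" by (simp add: power_le_one)
  moreover have "0 \<le> p \<Longrightarrow> p \<le> 1 \<Longrightarrow> 0 \<le> (1 + p) / 2 \<and> (1 + p) / 2 \<le> 1" for p :: real by simp
  ultimately show ?case unfolding scalar_iter.simps by (metis zero_le_power2)
qed simp

lemma scalar_iter_Suc_ge: "scalar_iter n \<le> scalar_iter (Suc n)"
proof -
  have "0 \<le> (1 - scalar_iter n)\<^sup>2" by simp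
  then show ?thesis by (simp add: power2_eq_square algebra_simps)
qed

lemma Cauchy_scalar_iter: "Cauchy scalar_iter"
proof -
  have "incseq scalar_iter" by (rule incseq_SucI) (rule scalar_iter_Suc_ge)
  moreover have "bdd_above (range scalar_iter)"
    using scalar_iter_bounds by (auto intro: bdd_aboveI2[of _ _ 1])
  ultimately have "scalar_iter \<longlonglongrightarrow> (SUP n. scalar_iter n)" by (rule LIMSEQ_incseq_SUP[rotated])
  then show ?thesis using LIMSEQ_imp_Cauchy by blast
qed

context
  fixes X :: "'a::{real_inner,complete_space} \<Rightarrow> 'a"
  assumes lin: "linear X" and contr: "\<And>x. norm (X x) \<le> norm x"
begin

lemma linear_sqrt_iter: "linear (sqrt_iter X n)"
proof (induction n)
  case (Suc n)
  show ?case
    by (rule linearI)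
      (simp_all add: linear_add[OF lin] linear_add[OF Suc] linear_scale[OF lin] linear_scale[OF Suc]
        algebra_simps)
qed (simp add: linear_iff)

lemma norm_sqrt_iter: "norm (sqrt_iter X n x) \<le> scalar_iter n * norm x"
proof (induction n arbitrary: x)
  case (Suc n)
  have "norm (sqrt_iter X n (sqrt_iter X n x)) \<le> scalar_iter n * (scalar_iter n * norm x)"
    by (rule order_trans[OF Suc]) (intro mult_left_mono Suc, simp add: scalar_iter_bounds)
  then have "norm (X x + sqrt_iter X n (sqrt_iter X n x))
      \<le> norm x + scalar_iter n * (scalar_iter n * norm x)"
    using contr[of x] norm_triangle_ineq[of "X x" "sqrt_iter X n (sqrt_iter X n x)"] by linarith
  then show ?case
    by (simp add: power2_eq_square algebra_simps flip: scaleR_add_right)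
qed simp

text \<open>Majorant method: a difference of squares splits as Y'^2 - Y^2 = Y' (Y' - Y) + (Y' - Y)
  Y, and the scalar increments satisfy the identical recursion with equality.\<close>

lemma sqrt_iter_Suc_diff:
  "norm (sqrt_iter X (Suc n) x - sqrt_iter X n x) \<le> (scalar_iter (Suc n) - scalar_iter n) * norm x"
proof (induction n arbitrary: x)
  case 0
  then show ?case using contr[of x] by simp
next
  case (Suc n)
  let ?Y = "sqrt_iter X" and ?q = "scalar_iter"
  have "norm (?Y (Suc n) (?Y (Suc n) x - ?Y n x)) \<le> ?q (Suc n) * ((?q (Suc n) - ?q n) * norm x)"
    by (rule order_trans[OF norm_sqrt_iter])
      (rule mult_left_mono[OF Suc], simp add: scalar_iter_bounds del: scalar_iter.simps)
  moreover have "norm (?Y (Suc n) (?Y n x) - ?Y n (?Y n x))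
      \<le> (?q (Suc n) - ?q n) * (?q n * norm x)"
    by (rule order_trans[OF Suc])
      (rule mult_left_mono[OF norm_sqrt_iter], simp add: scalar_iter_Suc_ge del: scalar_iter.simps)
  moreover have "?Y (Suc (Suc n)) x - ?Y (Suc n) x
      = (?Y (Suc n) (?Y (Suc n) x - ?Y n x) + (?Y (Suc n) (?Y n x) - ?Y n (?Y n x))) /\<^sub>R 2"
    unfolding linear_diff[OF linear_sqrt_iter]
    by (rule trans[OF arg_cong2[where f = minus,
            OF sqrt_iter.simps(2)[of X "Suc n" x] sqrt_iter.simps(2)[of X n x]]])
       (simp add: algebra_simps del: sqrt_iter.simps)
  moreover have "(?q (Suc (Suc n)) - ?q (Suc n)) * norm x
      = (?q (Suc n) * ((?q (Suc n) - ?q n) * norm x) + (?q (Suc n) - ?q n) * (?q n * norm x)) / 2"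
    by (rule trans[OF arg_cong[where f = "\<lambda>a. a * norm x", OF arg_cong2[where f = minus,
            OF scalar_iter.simps(2)[of "Suc n"] scalar_iter.simps(2)[of n]]]])
       (simp add: algebra_simps power2_eq_square add_divide_distrib diff_divide_distrib
          del: scalar_iter.simps)
  ultimately show ?case
    using norm_triangle_ineq[of "?Y (Suc n) (?Y (Suc n) x - ?Y n x)"
        "?Y (Suc n) (?Y n x) - ?Y n (?Y n x)"]
    by (simp del: sqrt_iter.simps scalar_iter.simps)
qed

lemma sqrt_iter_diff:
  "n \<le> m \<Longrightarrow> norm (sqrt_iter X m x - sqrt_iter X n x) \<le> (scalar_iter m - scalar_iter n) * norm x"
proof (induction m rule: dec_induct)
  case (step m)
  then show ?case
    using sqrt_iter_Suc_diff[of m x]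
      norm_triangle_ineq[of "sqrt_iter X (Suc m) x - sqrt_iter X m x" "sqrt_iter X m x - sqrt_iter X n x"]
    by (simp add: algebra_simps del: sqrt_iter.simps scalar_iter.simps)
qed simp

lemma convergent_sqrt_iter: "convergent (\<lambda>n. sqrt_iter X n x)"
proof -
  have "Cauchy (\<lambda>n. sqrt_iter X n x)"
  proof (rule CauchyI)
    fix e :: real assume "e > 0"
    \<comment> \<open>The +1 keeps the divisor positive when x = 0.\<close>
    then have "e / (norm x + 1) > 0" by (simp add: add_nonneg_pos)
    then obtain N where N: "\<forall>m\<ge>N. \<forall>n\<ge>N. norm (scalar_iter m - scalar_iter n) < e / (norm x + 1)"
      using CauchyD[OF Cauchy_scalar_iter] by blast
    have *: "norm (sqrt_iter X m x - sqrt_iter X n x) < e" if "m \<ge> N" "n \<ge> N" "n \<le> m" for m n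
    proof -
      have "norm (sqrt_iter X m x - sqrt_iter X n x) \<le> (scalar_iter m - scalar_iter n) * norm x"
        by (rule sqrt_iter_diff) fact
      also have "\<dots> \<le> (e / (norm x + 1)) * norm x"
        using N[rule_format, OF that(1,2)] by (intro mult_right_mono) auto
      also have "\<dots> = e * (norm x / (norm x + 1))" by simp
      also have "\<dots> < e * 1"
        using \<open>e > 0\<close> by (intro mult_strict_left_mono) (simp_all add: add_nonneg_pos)
      finally show ?thesis by simp
    qed
    have "norm (sqrt_iter X m x - sqrt_iter X n x) < e" if "m \<ge> N" "n \<ge> N" for m n
      using *[of m n] *[of n m] that by (cases "n \<le> m") (auto simp: norm_minus_commute)
    then show "\<exists>M. \<forall>m\<ge>M. \<forall>n\<ge>M. norm (sqrt_iter X m x - sqrt_iter X n x) < e" by blast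
  qed
  then show ?thesis by (simp add: Cauchy_convergent_iff)
qed

text \<open>With \<open>Y\<close> the limit of the iteration, \<open>Y = (X + Y\<^sup>2) / 2\<close>, so that \<open>(1 - Y)\<^sup>2 = 1 - X\<close>.\<close>

lemma nonneg_sqrt_exists:
  assumes sym: "\<And>x y. inner (X x) y = inner x (X y)"
  obtains E where "bounded_linear E" "\<And>x. E (E x) = x - X x" "\<And>x y. inner (E x) y = inner x (E y)"
    "\<And>x. 0 \<le> inner x (E x)" "\<And>x. norm (x - E x) \<le> norm x"
    "\<forall>L. bounded_linear L \<longrightarrow> (\<forall>x. L (X x) = X (L x)) \<longrightarrow> (\<forall>x. L (E x) = E (L x))"
proof -
  let ?Y = "sqrt_iter X"
  define Y where "Y x = lim (\<lambda>n. ?Y n x)" for x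
  define E where "E x = x - Y x" for x
  have Y: "(\<lambda>n. ?Y n x) \<longlonglongrightarrow> Y x" for x
    using convergent_sqrt_iter convergent_LIMSEQ_iff Y_def by metis
  have linY: "linear Y"
  proof (rule linearI)
    show "Y (x + y) = Y x + Y y" for x y
      using tendsto_add[OF Y[of x] Y[of y]] Y[of "x + y"]
      by (intro LIMSEQ_unique[OF Y]) (simp add: linear_add[OF linear_sqrt_iter])
    show "Y (c *\<^sub>R x) = c *\<^sub>R Y x" for c x
      using tendsto_scaleR[OF tendsto_const Y[of x], of c]
      by (intro LIMSEQ_unique[OF Y]) (simp add: linear_scale[OF linear_sqrt_iter])
  qed
  have norm1: "norm (?Y n x) \<le> norm x" for n x
    using norm_sqrt_iter[of n x] scalar_iter_bounds[of n]
      mult_right_mono[of "scalar_iter n" 1 "norm x"] by simp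
  have normY: "norm (Y x) \<le> norm x" for x
    by (rule LIMSEQ_le_const2[OF tendsto_norm[OF Y]]) (use norm1 in auto)
  \<comment> \<open>Both the operator and its argument vary with n; the uniform bound
    \<open>norm1\<close> allows replacing the inner iterate by its limit first.\<close>
  have YY: "(\<lambda>n. ?Y n (?Y n x)) \<longlonglongrightarrow> Y (Y x)" for x
  proof -
    have "(\<lambda>n. ?Y n (?Y n x - Y x)) \<longlonglongrightarrow> 0"
    proof (rule Lim_null_comparison)
      show "\<forall>\<^sub>F n in sequentially. norm (?Y n (?Y n x - Y x)) \<le> norm (?Y n x - Y x)"
        using norm1 by simp
      show "(\<lambda>n. norm (?Y n x - Y x)) \<longlonglongrightarrow> 0"
        using Y[of x] tendsto_norm_zero LIM_zero by blast
    qed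
    from tendsto_add[OF this Y[of "Y x"]] show ?thesis
      by (simp add: linear_diff[OF linear_sqrt_iter])
  qed
  have fix_eq: "Y x = (X x + Y (Y x)) /\<^sub>R 2" for x
  proof (rule LIMSEQ_unique)
    show "(\<lambda>n. ?Y (Suc n) x) \<longlonglongrightarrow> Y x" using Y by (rule LIMSEQ_Suc)
    show "(\<lambda>n. ?Y (Suc n) x) \<longlonglongrightarrow> (X x + Y (Y x)) /\<^sub>R 2"
      by (simp del: divideR_right) (intro tendsto_intros YY)
  qed
  have symY: "inner (Y x) y = inner x (Y y)" for x y
  proof -
    have s: "inner (?Y n x) y = inner x (?Y n y)" for n x y
      by (induction n arbitrary: x y) (auto simp: inner_add_left inner_add_right sym)
    have "(\<lambda>n. inner (?Y n x) y) \<longlonglongrightarrow> inner (Y x) y" "(\<lambda>n. inner x (?Y n y)) \<longlonglongrightarrow> inner x (Y y)"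
      by (intro tendsto_intros Y)+
    then show ?thesis using s LIMSEQ_unique by auto
  qed
  show ?thesis
  proof (rule that[of E])
    have "bounded_linear Y"
      using normY by (intro bounded_linear_intro[of _ 1]) (auto simp: linear_add linear_scale linY)
    then show "bounded_linear E"
      unfolding E_def[abs_def] by (intro bounded_linear_sub bounded_linear_ident)
    show "E (E x) = x - X x" for x
    proof -
      have "Y x + Y x = X x + Y (Y x)" by (subst (1 2) fix_eq) (simp add: scaleR_2[symmetric])
      then show ?thesis by (simp add: E_def linear_diff[OF linY] algebra_simps)
    qed
    show "inner (E x) y = inner x (E y)" for x y by (simp add: E_def inner_diff symY)
    \<comment> \<open>Since Y is a contraction, Cauchy-Schwarz gives (x, Y x) \<le> |x|^2, which is
      nonnegativity of E = 1 - Y.\<close>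
    show "0 \<le> inner x (E x)" for x
    proof -
      have "inner x (Y x) \<le> norm x * norm (Y x)" by (rule norm_cauchy_schwarz)
      also have "\<dots> \<le> norm x * norm x" by (intro mult_left_mono normY) simp
      finally show ?thesis
        by (simp add: E_def inner_diff power2_norm_eq_inner[symmetric] power2_eq_square)
    qed
    show "norm (x - E x) \<le> norm x" for x by (simp add: E_def normY)
    \<comment> \<open>Commutation with X passes to all iterates and then to the limit. This clause
      stands in for the functional calculus in everything that follows.\<close>
    show "\<forall>L. bounded_linear L \<longrightarrow> (\<forall>x. L (X x) = X (L x)) \<longrightarrow> (\<forall>x. L (E x) = E (L x))"
    proof (intro allI impI)
      fix L x assume L: "bounded_linear L" and com: "\<forall>x. L (X x) = X (L x)"
      interpret bounded_linear L by fact
      have c: "L (?Y n x) = ?Y n (L x)" for n x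
        by (induction n arbitrary: x) (auto simp: zero scaleR add com)
      have "(\<lambda>n. L (?Y n x)) \<longlonglongrightarrow> L (Y x)" by (intro tendsto Y)
      then have "L (Y x) = Y (L x)" using LIMSEQ_unique Y c by auto
      then show "L (E x) = E (L x)" by (simp add: E_def diff)
    qed
  qed
qed

end

section \<open>Complex Hilbert spaces and unbounded operators\<close>

instance chilbert_space \<subseteq> banach ..

lemma scaleC_zero_right [simp]: "c *\<^sub>C (0::'a::chilbert_space) = 0"
  using scaleC_add_right[of c "0::'a" 0] by simp

lemma scaleC_minus_right: "c *\<^sub>C (- x) = - (c *\<^sub>C (x::'a::chilbert_space))"
  using scaleC_add_right[of c x "- x"] by (simp add: eq_neg_iff_add_eq_0 add.commute)

lemma scaleC_diff_right: "c *\<^sub>C (x - y) = c *\<^sub>C x - c *\<^sub>C (y::'a::chilbert_space)"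
  using scaleC_add_right[of c x "- y"] by (simp add: scaleC_minus_right)

lemma scaleC_one [simp]: "1 *\<^sub>C (x::'a::chilbert_space) = x"
  using scaleC_of_real[of 1 x] by simp

lemma scaleC_minus_left: "(- c) *\<^sub>C x = - (c *\<^sub>C (x::'a::chilbert_space))"
proof -
  have "0 *\<^sub>C x = 0" using scaleC_of_real[of 0 x] by simp
  then show ?thesis using scaleC_add_left[of "- c" c x] by (simp add: eq_neg_iff_add_eq_0)
qed

lemma cinner_scaleC_left: "cinner (c *\<^sub>C x) y = cnj c * cinner x (y::'a::chilbert_space)"
  using cinner_commute[of "c *\<^sub>C x" y] cinner_commute[of x y] by (simp add: cinner_scaleC_right)

lemma inner_scaleC_left: "inner (c *\<^sub>C x) y = inner x (cnj c *\<^sub>C (y::'a::chilbert_space))"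
  by (simp add: Re_cinner[symmetric] cinner_scaleC_left cinner_scaleC_right)

text \<open>Im (x, y) = - Re (x, i y), so an identity of real inner products on a set closed under
  multiplication by i is already an identity of complex ones.\<close>

lemma cinner_eq_inner:
  "cinner x (y::'a::chilbert_space) = Complex (inner x y) (- inner x (\<i> *\<^sub>C y))"
  using Re_cinner[of x "\<i> *\<^sub>C y"] by (simp add: complex_eq_iff Re_cinner cinner_scaleC_right)

lemma cinner_self: "cinner x (x::'a::chilbert_space) = complex_of_real ((norm x)\<^sup>2)"
proof -
  have "Im (cinner x x) = 0" using cinner_commute[of x x] by (metis complex_cnj complex.sel(2) equal_neg_zero neg_equal_zero complex_surj)
  then show ?thesis by (simp add: complex_eq_iff Re_cinner power2_norm_eq_inner)
qed

lemma norm_scaleC: "norm (c *\<^sub>C (x::'a::chilbert_space)) = cmod c * norm x"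
proof -
  have "complex_of_real ((norm (c *\<^sub>C x))\<^sup>2) = c * cnj c * complex_of_real ((norm x)\<^sup>2)"
    unfolding cinner_self[symmetric] by (simp add: cinner_scaleC_left cinner_scaleC_right)
  also have "\<dots> = complex_of_real ((cmod c * norm x)\<^sup>2)"
    unfolding complex_norm_square[symmetric] by (simp add: power_mult_distrib)
  finally have "(norm (c *\<^sub>C x))\<^sup>2 = (cmod c * norm x)\<^sup>2" by (simp only: of_real_eq_iff)
  then show ?thesis by (simp add: power2_eq_iff_nonneg)
qed

text \<open>Scalar multiplication is treated as one more bounded operator; complex homogeneity of
  the roots and of the semigroup then follows from their commutation properties.\<close>

lemma bounded_linear_scaleC: "bounded_linear (\<lambda>x::'a::chilbert_space. c *\<^sub>C x)"
proof (rule bounded_linear_intro[of _ "cmod c"])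
  show "c *\<^sub>C (x + y) = c *\<^sub>C x + c *\<^sub>C y" for x y :: 'a by (rule scaleC_add_right)
  show "c *\<^sub>C (r *\<^sub>R x) = r *\<^sub>R (c *\<^sub>C x)" for r and x :: 'a
    by (simp add: scaleC_of_real[symmetric] scaleC_scaleC mult.commute)
  show "norm (c *\<^sub>C x) \<le> norm x * cmod c" for x :: 'a by (simp add: norm_scaleC mult.commute)
qed

lemma clinear_map_linear: "clinear_map T \<Longrightarrow> linear T"
  by (rule linearI) (auto simp: clinear_map_def simp flip: scaleC_of_real)

text \<open>Polarization gives the real part, and replacing y by i y gives the imaginary
  part.\<close>

lemma clinear_map_isometry:
  assumes T: "clinear_map T" and n: "\<And>x. norm (T x) = norm x"
  shows "cinner (T x) (T y) = cinner x y"
proof -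
  have i: "inner (T x) (T y) = inner x y" for x y
  proof -
    have "T x + T y = T (x + y)" using T by (simp add: clinear_map_def)
    then show ?thesis by (simp add: dot_norm n)
  qed
  moreover have "\<i> *\<^sub>C T y = T (\<i> *\<^sub>C y)" using T by (simp add: clinear_map_def)
  ultimately show ?thesis by (simp add: cinner_eq_inner)
qed

section \<open>Operators as partial functions: graphs, closedness, adjoints\<close>

lemma map_eq_if_same_graph:
  assumes "\<And>x y. S x = Some y \<longleftrightarrow> T x = Some y" shows "S = T"
proof
  fix x show "S x = T x"
  proof (cases "T x")
    case None
    then have "S x \<noteq> Some y" for y using assms[of x y] by simp
    then show ?thesis using None by (cases "S x") auto
  next
    case (Some y)
    then show ?thesis using assms[of x y] by simp
  qed
qed

lemma dom_map_comp_iff: "f \<in> dom (S \<circ>\<^sub>m T) \<longleftrightarrow> f \<in> dom T \<and> T \<cdot> f \<in> dom S"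
  by (auto simp: map_comp_def split: option.splits)

lemma app_map_comp: "f \<in> dom T \<Longrightarrow> (S \<circ>\<^sub>m T) \<cdot> f = S \<cdot> (T \<cdot> f)"
  by (auto simp: map_comp_def)

lemma linear_op_0: "linear_op T \<Longrightarrow> 0 \<in> dom T \<and> T \<cdot> 0 = 0"
  unfolding linear_op_def by (metis add_cancel_right_left add.right_neutral)

lemma linear_op_add:
  "linear_op T \<Longrightarrow> f \<in> dom T \<Longrightarrow> g \<in> dom T \<Longrightarrow> f + g \<in> dom T \<and> T \<cdot> (f + g) = T \<cdot> f + T \<cdot> g"
  unfolding linear_op_def by blast

lemma linear_op_scaleC:
  "linear_op T \<Longrightarrow> f \<in> dom T \<Longrightarrow> c *\<^sub>C f \<in> dom T \<and> T \<cdot> (c *\<^sub>C f) = c *\<^sub>C (T \<cdot> f)"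
  unfolding linear_op_def by blast

lemma linear_op_scaleR:
  "linear_op T \<Longrightarrow> f \<in> dom T \<Longrightarrow> r *\<^sub>R f \<in> dom T \<and> T \<cdot> (r *\<^sub>R f) = r *\<^sub>R (T \<cdot> f)"
  using linear_op_scaleC[of T f "complex_of_real r"] by (simp add: scaleC_of_real)

lemma linear_op_diff:
  "linear_op T \<Longrightarrow> f \<in> dom T \<Longrightarrow> g \<in> dom T \<Longrightarrow> f - g \<in> dom T \<and> T \<cdot> (f - g) = T \<cdot> f - T \<cdot> g"
  using linear_op_add[of T f "- 1 *\<^sub>R g"] linear_op_scaleR[of T g "- 1"] by simp

lemma subspace_dom: "linear_op T \<Longrightarrow> subspace (dom T)"
  by (rule subspaceI) (simp_all add: linear_op_0 linear_op_add linear_op_scaleR)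

lemma closed_op_iff:
  "closed_op T \<longleftrightarrow> (\<forall>u f g. (\<forall>n. u n \<in> dom T) \<longrightarrow> u \<longlonglongrightarrow> f \<longrightarrow> (\<lambda>n. T \<cdot> u n) \<longlonglongrightarrow> g
    \<longrightarrow> f \<in> dom T \<and> T \<cdot> f = g)" (is "_ \<longleftrightarrow> ?R")
proof
  assume cl: "closed_op T"
  show ?R
  proof (intro allI impI)
    fix u f g assume *: "\<forall>n. u n \<in> dom T" "u \<longlonglongrightarrow> f" "(\<lambda>n. T \<cdot> u n) \<longlonglongrightarrow> g"
    have "(f, g) \<in> Map.graph T"
    proof (rule closed_sequentially)
      show "closed (Map.graph T)" using cl by (simp add: closed_op_def)
      show "(u n, T \<cdot> u n) \<in> Map.graph T" for n
        using *(1)[rule_format, of n] by (auto simp: Map.graph_def)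
      show "(\<lambda>n. (u n, T \<cdot> u n)) \<longlonglongrightarrow> (f, g)" by (intro tendsto_Pair *)
    qed
    then show "f \<in> dom T \<and> T \<cdot> f = g" by (auto simp: Map.graph_def)
  qed
next
  assume R: ?R
  show "closed_op T" unfolding closed_op_def closed_sequential_limits
  proof (intro allI impI)
    fix x l assume *: "(\<forall>n. x n \<in> Map.graph T) \<and> x \<longlonglongrightarrow> l"
    have g: "x n \<in> Map.graph T" for n using * by blast
    have "fst (x n) \<in> dom T" for n using g[of n] by (force simp: Map.graph_def)
    moreover have "T \<cdot> fst (x n) = snd (x n)" for n using g[of n] by (force simp: Map.graph_def)
    moreover have "(\<lambda>n. fst (x n)) \<longlonglongrightarrow> fst l" "(\<lambda>n. snd (x n)) \<longlonglongrightarrow> snd l"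
      using * by (auto intro: tendsto_fst tendsto_snd)
    ultimately have "fst l \<in> dom T \<and> T \<cdot> fst l = snd l"
      by (intro R[rule_format, of "\<lambda>n. fst (x n)"]) simp_all
    then show "l \<in> Map.graph T" by (cases l) (auto simp: Map.graph_def)
  qed
qed

lemma closed_opD:
  assumes "closed_op T" "\<And>n. u n \<in> dom T" "u \<longlonglongrightarrow> f" "(\<lambda>n. T \<cdot> u n) \<longlonglongrightarrow> g"
  shows "f \<in> dom T \<and> T \<cdot> f = g"
  using assms unfolding closed_op_iff by blast

text \<open>Since \<open>dom T\<close> is invariant under multiplication by \<open>\<i>\<close>, the real inner product suffices to
  determine the adjoint.\<close>

lemma adj_eq_Some_iff:
  assumes T: "linear_op T" "densely_defined T"
  shows "adj T g = Some h \<longleftrightarrow> (\<forall>f\<in>dom T. inner g (T \<cdot> f) = inner h f)"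
proof -
  have iff: "(\<forall>f\<in>dom T. cinner g (T \<cdot> f) = cinner h f) \<longleftrightarrow> (\<forall>f\<in>dom T. inner g (T \<cdot> f) = inner h f)"
    for h
  proof
    assume *: "\<forall>f\<in>dom T. inner g (T \<cdot> f) = inner h f"
    show "\<forall>f\<in>dom T. cinner g (T \<cdot> f) = cinner h f"
    proof
      fix f assume f: "f \<in> dom T"
      have "inner g (\<i> *\<^sub>C (T \<cdot> f)) = inner h (\<i> *\<^sub>C f)"
        using * linear_op_scaleC[OF T(1) f, of \<i>] by metis
      then show "cinner g (T \<cdot> f) = cinner h f" using * f by (simp add: cinner_eq_inner)
    qed
  qed (simp add: cinner_eq_inner)
  have unique: "h = h'"
    if "\<forall>f\<in>dom T. inner g (T \<cdot> f) = inner h f" "\<forall>f\<in>dom T. inner g (T \<cdot> f) = inner h' f" for h h'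
    using orthogonal_dense_imp_zero[of "dom T" "h - h'"] T(2) that
    by (simp add: densely_defined_def inner_diff_left)
  show ?thesis
  proof
    assume "adj T g = Some h"
    then have ex: "\<exists>h. \<forall>f\<in>dom T. inner g (T \<cdot> f) = inner h f"
      and h: "h = (THE h. \<forall>f\<in>dom T. inner g (T \<cdot> f) = inner h f)"
      unfolding adj_def iff by (auto split: if_splits)
    have "\<exists>!h. \<forall>f\<in>dom T. inner g (T \<cdot> f) = inner h f"
      using ex unique by (intro ex_ex1I) simp_all
    from theI'[OF this] show "\<forall>f\<in>dom T. inner g (T \<cdot> f) = inner h f" unfolding h .
  next
    assume *: "\<forall>f\<in>dom T. inner g (T \<cdot> f) = inner h f"
    then have "(THE h. \<forall>f\<in>dom T. inner g (T \<cdot> f) = inner h f) = h"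
      by (intro the_equality unique)
    then show "adj T g = Some h" unfolding adj_def iff using * by auto
  qed
qed

lemma inner_adj:
  assumes "linear_op T" "densely_defined T" "g \<in> dom (adj T)" "f \<in> dom T"
  shows "inner g (T \<cdot> f) = inner (adj T \<cdot> g) f"
  using assms adj_eq_Some_iff[of T g "adj T \<cdot> g"] by auto

lemma linear_op_adj:
  assumes T: "linear_op T" "densely_defined T"
  shows "linear_op (adj T)"
proof -
  have add: "adj T (f + g) = Some (adj T \<cdot> f + adj T \<cdot> g)" if "f \<in> dom (adj T)" "g \<in> dom (adj T)" for f g
    unfolding adj_eq_Some_iff[OF T] using inner_adj[OF T] that by (simp add: inner_add_left)
  have scale: "adj T (c *\<^sub>C f) = Some (c *\<^sub>C (adj T \<cdot> f))" if f: "f \<in> dom (adj T)" for c f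
    unfolding adj_eq_Some_iff[OF T]
  proof
    fix u assume u: "u \<in> dom T"
    have "inner f (T \<cdot> (cnj c *\<^sub>C u)) = inner (adj T \<cdot> f) (cnj c *\<^sub>C u)"
      using inner_adj[OF T f] linear_op_scaleC[OF T(1) u] by blast
    then show "inner (c *\<^sub>C f) (T \<cdot> u) = inner (c *\<^sub>C (adj T \<cdot> f)) u"
      using linear_op_scaleC[OF T(1) u, of "cnj c"] by (simp add: inner_scaleC_left)
  qed
  have "adj T 0 = Some 0" unfolding adj_eq_Some_iff[OF T] by simp
  then show ?thesis
    unfolding linear_op_def using add scale by (auto simp: domIff)
qed

lemma closed_op_adj:
  assumes T: "linear_op T" "densely_defined T"
  shows "closed_op (adj T)"
  unfolding closed_op_iff
proof (intro allI impI)
  fix u f g assume *: "\<forall>n. u n \<in> dom (adj T)" "u \<longlonglongrightarrow> f" "(\<lambda>n. adj T \<cdot> u n) \<longlonglongrightarrow> g"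
  have "adj T f = Some g"
    unfolding adj_eq_Some_iff[OF T]
  proof
    fix v assume v: "v \<in> dom T"
    have "(\<lambda>n. inner (u n) (T \<cdot> v)) \<longlonglongrightarrow> inner f (T \<cdot> v)" by (intro tendsto_intros *)
    moreover have "(\<lambda>n. inner (adj T \<cdot> u n) v) \<longlonglongrightarrow> inner g v" by (intro tendsto_intros *)
    moreover have "inner (u n) (T \<cdot> v) = inner (adj T \<cdot> u n) v" for n
      using inner_adj[OF T _ v] * by blast
    ultimately show "inner f (T \<cdot> v) = inner g v" by (auto intro: LIMSEQ_unique)
  qed
  then show "f \<in> dom (adj T) \<and> adj T \<cdot> f = g" by auto
qed

section \<open>The absolute value of a closed operator\<close>

text \<open>The resolvent (1 + T)^-1 as a total function. The description is meaningful once 1 + T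
  is bijective, which is shown below for \<open>adj A\<close> composed with A.\<close>

definition inv_one_plus :: "('a::chilbert_space \<rightharpoonup> 'a) \<Rightarrow> 'a \<Rightarrow> 'a" where
  "inv_one_plus T g = (THE f. f \<in> dom T \<and> f + T \<cdot> f = g)"

locale closed_dense_op =
  fixes A :: "'a::chilbert_space \<rightharpoonup> 'b::chilbert_space"
  assumes lin: "linear_op A" and dense: "densely_defined A" and closed: "closed_op A"
begin

abbreviation T :: "'a \<rightharpoonup> 'a" where "T \<equiv> adj A \<circ>\<^sub>m A"
abbreviation B :: "'a \<Rightarrow> 'a" where "B \<equiv> inv_one_plus T"

lemma dom_T: "f \<in> dom T \<longleftrightarrow> f \<in> dom A \<and> A \<cdot> f \<in> dom (adj A)"
  by (rule dom_map_comp_iff)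

lemma linear_op_T: "linear_op T"
proof -
  note ladj = linear_op_adj[OF lin dense]
  show ?thesis
    unfolding linear_op_def
    by (simp add: dom_T app_map_comp linear_op_0[OF lin] linear_op_0[OF ladj] linear_op_add[OF lin]
        linear_op_add[OF ladj] linear_op_scaleC[OF lin] linear_op_scaleC[OF ladj] del: domIff)
qed

lemma inner_T:
  assumes "g \<in> dom A" "f \<in> dom T"
  shows "inner (A \<cdot> f) (A \<cdot> g) = inner (T \<cdot> f) g"
  using assms inner_adj[OF lin dense, of "A \<cdot> f" g] by (simp add: dom_T app_map_comp)

text \<open>The cross term is 2 (f, T f) = 2 |A f|^2. This one identity yields injectivity of 1 + T
  and the contraction bounds for B, 1 - B and A B.\<close>

lemma norm_one_plus_T:
  assumes "f \<in> dom T"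
  shows "(norm (f + T \<cdot> f))\<^sup>2 = (norm f)\<^sup>2 + 2 * (norm (A \<cdot> f))\<^sup>2 + (norm (T \<cdot> f))\<^sup>2"
  using inner_T[of f f] assms
  by (simp add: dom_T power2_norm_eq_inner inner_add_left inner_add_right inner_commute)

lemma subspace_graph: "subspace (Map.graph A)"
proof (rule subspaceI)
  show "0 \<in> Map.graph A"
    using linear_op_0[OF lin] by (auto simp: Map.graph_def zero_prod_def)
  show "x + y \<in> Map.graph A" if "x \<in> Map.graph A" "y \<in> Map.graph A" for x y
    using that linear_op_add[OF lin, of "fst x" "fst y"] by (fastforce simp: Map.graph_def)
  show "c *\<^sub>R x \<in> Map.graph A" if "x \<in> Map.graph A" for x c
    using that linear_op_scaleR[OF lin, of "fst x" c] by (fastforce simp: Map.graph_def)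
qed

text \<open>Von Neumann: the projection of \<open>(g, 0)\<close> onto the graph of \<open>A\<close> is \<open>(f, A f)\<close> with
  \<open>f + A\<^sup>* A f = g\<close>.\<close>

lemma one_plus_T_surj: "\<exists>f. f \<in> dom T \<and> f + T \<cdot> f = g"
proof -
  obtain p where p: "p \<in> Map.graph A" "\<And>w. w \<in> Map.graph A \<Longrightarrow> inner ((g, 0) - p) w = 0"
    using orthogonal_projection[OF subspace_graph] closed unfolding closed_op_def by metis
  have "\<exists>f. f \<in> dom A \<and> p = (f, A \<cdot> f)" using p(1) by (force simp: Map.graph_def)
  then obtain f where f: "f \<in> dom A" "p = (f, A \<cdot> f)" by blast
  \<comment> \<open>Orthogonality of (g - f, - A f) to every (u, A u) is exactly the defining
    identity of the adjoint at A f.\<close>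
  have "adj A (A \<cdot> f) = Some (g - f)"
    unfolding adj_eq_Some_iff[OF lin dense]
  proof
    fix u assume u: "u \<in> dom A"
    then have "(u, A \<cdot> u) \<in> Map.graph A" by (auto simp: Map.graph_def)
    from p(2)[OF this] show "inner (A \<cdot> f) (A \<cdot> u) = inner (g - f) u"
      by (simp add: f inner_diff_left)
  qed
  then show ?thesis using f by (intro exI[of _ f]) (auto simp: dom_T app_map_comp)
qed

lemma one_plus_T_inj:
  assumes "f \<in> dom T" "f' \<in> dom T" "f + T \<cdot> f = f' + T \<cdot> f'"
  shows "f = f'"
proof -
  have d: "f - f' \<in> dom T \<and> T \<cdot> (f - f') = T \<cdot> f - T \<cdot> f'"
    using linear_op_diff[OF linear_op_T] assms by blast
  then have "(f - f') + T \<cdot> (f - f') = (f + T \<cdot> f) - (f' + T \<cdot> f')" by simp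
  then have "(f - f') + T \<cdot> (f - f') = 0" using assms(3) by simp
  then have "(norm (f - f'))\<^sup>2 + 2 * (norm (A \<cdot> (f - f')))\<^sup>2 + (norm (T \<cdot> (f - f')))\<^sup>2 = 0"
    using norm_one_plus_T[of "f - f'"] d by simp
  then have "(norm (f - f'))\<^sup>2 = 0" by (smt (verit) zero_le_power2)
  then show ?thesis by simp
qed

lemma B: "B g \<in> dom T" "B g + T \<cdot> B g = g"
proof -
  have "\<exists>!f. f \<in> dom T \<and> f + T \<cdot> f = g" using one_plus_T_surj one_plus_T_inj by blast
  from theI'[OF this] show "B g \<in> dom T" "B g + T \<cdot> B g = g" by (auto simp: inv_one_plus_def)
qed

lemma T_B: "T \<cdot> B g = g - B g"
  using B(2)[of g] by (simp add: algebra_simps)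

lemma B_unique: "f \<in> dom T \<Longrightarrow> B (f + T \<cdot> f) = f"
  using one_plus_T_inj B by blast

lemma B_add: "B (f + g) = B f + B g"
  using linear_op_add[OF linear_op_T B(1)[of f] B(1)[of g]] B_unique[of "B f + B g"]
  by (simp add: T_B)

lemma B_scaleC: "B (c *\<^sub>C f) = c *\<^sub>C B f"
  using linear_op_scaleC[OF linear_op_T B(1)[of f], of c] B_unique[of "c *\<^sub>C B f"]
  by (simp add: T_B scaleC_diff_right)

lemma linear_B: "linear B"
  by (intro clinear_map_linear) (simp add: clinear_map_def B_add B_scaleC)

lemma norm_B: "norm (B g) \<le> norm g" and norm_id_minus_B: "norm (g - B g) \<le> norm g"
  and norm_A_B: "norm (A \<cdot> B g) \<le> norm g"
proof -
  have *: "(norm g)\<^sup>2 = (norm (B g))\<^sup>2 + 2 * (norm (A \<cdot> B g))\<^sup>2 + (norm (g - B g))\<^sup>2"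
    using norm_one_plus_T[OF B(1)[of g]] by (simp add: B(2) T_B)
  show "norm (B g) \<le> norm g" "norm (g - B g) \<le> norm g" "norm (A \<cdot> B g) \<le> norm g"
    by (rule power2_le_imp_le, use * in \<open>smt (verit) zero_le_power2\<close>, simp)+
qed

lemma B_in_dom_A: "B g \<in> dom A" using B(1) by (simp add: dom_T)

text \<open>B g represents the functional f -> (f, g) in the graph inner product of A. Hence a
  vector that is graph-orthogonal to the range of B is orthogonal to everything.\<close>

lemma inner_B:
  assumes "f \<in> dom A"
  shows "inner f (B g) + inner (A \<cdot> f) (A \<cdot> B g) = inner f g"
  using inner_T[OF assms B(1)[of g]] by (simp add: T_B inner_commute inner_diff_right)

lemma B_sym: "inner (B f) g = inner f (B g)"
  using inner_B[OF B_in_dom_A, of f g] inner_B[OF B_in_dom_A, of g f] by (simp add: inner_commute)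

text \<open>\<open>dom T\<close> is a core of A: project (f, A f) onto the closure of the graph of A
  restricted to \<open>dom T\<close>. The remainder is graph-orthogonal to every B g, so it vanishes
  by \<open>inner_B\<close>.\<close>

lemma dom_T_core:
  assumes f: "f \<in> dom A"
  obtains u where "\<And>n. u n \<in> dom T" "u \<longlonglongrightarrow> f" "(\<lambda>n. A \<cdot> u n) \<longlonglongrightarrow> A \<cdot> f"
proof -
  let ?V = "(\<lambda>u. (u, A \<cdot> u)) ` dom T"
  have V: "subspace ?V"
  proof (rule subspaceI)
    show "0 \<in> ?V"
      using linear_op_0[OF linear_op_T] linear_op_0[OF lin] by (force simp: zero_prod_def)
    show "x + y \<in> ?V" if xy: "x \<in> ?V" "y \<in> ?V" for x y
    proof -
      obtain a b where "a \<in> dom T" "x = (a, A \<cdot> a)" "b \<in> dom T" "y = (b, A \<cdot> b)" using xy by auto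
      then show ?thesis
        using linear_op_add[OF linear_op_T, of a b] linear_op_add[OF lin, of a b]
        by (intro image_eqI[of _ _ "a + b"]) (auto simp: dom_T)
    qed
    show "c *\<^sub>R x \<in> ?V" if x: "x \<in> ?V" for x c
    proof -
      obtain a where "a \<in> dom T" "x = (a, A \<cdot> a)" using x by auto
      then show ?thesis
        using linear_op_scaleR[OF linear_op_T, of a c] linear_op_scaleR[OF lin, of a c]
        by (intro image_eqI[of _ _ "c *\<^sub>R a"]) (auto simp: dom_T)
    qed
  qed
  have "(u, A \<cdot> u) \<in> Map.graph A" if "u \<in> dom T" for u
    using dom_T[THEN iffD1, OF that] by (auto simp: Map.graph_def)
  then have sub: "closure ?V \<subseteq> Map.graph A"
    using closed unfolding closed_op_def by (intro closure_minimal) auto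
  obtain p where p: "p \<in> closure ?V" "\<And>w. w \<in> closure ?V \<Longrightarrow> inner ((f, A \<cdot> f) - p) w = 0"
    using orthogonal_projection[OF subspace_closure[OF V] closed_closure] by metis
  have "p \<in> Map.graph A" using p(1) sub by blast
  then have "\<exists>a. a \<in> dom A \<and> p = (a, A \<cdot> a)" by (force simp: Map.graph_def)
  then obtain a where a: "a \<in> dom A" "p = (a, A \<cdot> a)" by blast
  have d: "f - a \<in> dom A" "A \<cdot> (f - a) = A \<cdot> f - A \<cdot> a"
    using linear_op_diff[OF lin f a(1)] by blast+
  have "inner (f - a) g = 0" for g
  proof -
    have "(B g, A \<cdot> B g) \<in> closure ?V" by (intro subsetD[OF closure_subset] imageI B(1))
    then have "inner (f - a) (B g) + inner (A \<cdot> (f - a)) (A \<cdot> B g) = 0"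
      using p(2)[of "(B g, A \<cdot> B g)"] by (simp add: a d)
    then show ?thesis using inner_B[OF d(1)] by simp
  qed
  from this[of "f - a"] have "f = a" by simp
  then obtain w where w: "\<And>n. w n \<in> ?V" "w \<longlonglongrightarrow> (f, A \<cdot> f)"
    using p(1) a(2) unfolding closure_sequential by auto
  show ?thesis
  proof (rule that[of "\<lambda>n. fst (w n)"])
    show "fst (w n) \<in> dom T" for n using w(1)[of n] by auto
    show "(\<lambda>n. fst (w n)) \<longlonglongrightarrow> f" using tendsto_fst[OF w(2)] by simp
    have "A \<cdot> fst (w n) = snd (w n)" for n using w(1)[of n] by auto
    then show "(\<lambda>n. A \<cdot> fst (w n)) \<longlonglongrightarrow> A \<cdot> f" using tendsto_snd[OF w(2)] by simp
  qed
qed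

end

text \<open>On the common domain of the squares, |S v|^2 = (T v, v) = |A v|^2. Approximating f in
  the graph norm of A from that core makes S u_n Cauchy, and closedness of S finishes.\<close>

lemma dom_subset_if_same_square:
  assumes "closed_dense_op A" "closed_dense_op S" and eq: "adj A \<circ>\<^sub>m A = adj S \<circ>\<^sub>m S"
    and f: "f \<in> dom A"
  shows "f \<in> dom S \<and> norm (S \<cdot> f) = norm (A \<cdot> f)"
proof -
  interpret A: closed_dense_op A by fact
  interpret S: closed_dense_op S by fact
  obtain u where u: "\<And>n. u n \<in> dom A.T" "u \<longlonglongrightarrow> f" "(\<lambda>n. A \<cdot> u n) \<longlonglongrightarrow> A \<cdot> f"
    using A.dom_T_core[OF f] by metis
  have n: "norm (S \<cdot> v) = norm (A \<cdot> v)" if "v \<in> dom A.T" for v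
    using A.inner_T[of v v] S.inner_T[of v v] that eq A.dom_T[of v] S.dom_T[of v]
    by (simp add: norm_eq_sqrt_inner)
  have uS: "u n \<in> dom S" "u n \<in> dom A" for n
    using u(1)[of n] S.dom_T[of "u n"] A.dom_T[of "u n"] eq by auto
  have "Cauchy (\<lambda>n. S \<cdot> u n)"
  proof (rule metric_CauchyI)
    fix e :: real assume "e > 0"
    then obtain M where M: "\<forall>m\<ge>M. \<forall>n\<ge>M. dist (A \<cdot> u m) (A \<cdot> u n) < e"
      using metric_CauchyD[OF LIMSEQ_imp_Cauchy[OF u(3)]] by blast
    have "dist (S \<cdot> u m) (S \<cdot> u n) = dist (A \<cdot> u m) (A \<cdot> u n)" for m n
      using n[of "u m - u n"] linear_op_diff[OF A.linear_op_T u(1) u(1), of m n]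
        linear_op_diff[OF A.lin uS(2) uS(2), of m n] linear_op_diff[OF S.lin uS(1) uS(1), of m n]
      by (simp add: dist_norm)
    then show "\<exists>M. \<forall>m\<ge>M. \<forall>n\<ge>M. dist (S \<cdot> u m) (S \<cdot> u n) < e" using M by auto
  qed
  then obtain g where g: "(\<lambda>n. S \<cdot> u n) \<longlonglongrightarrow> g" using Cauchy_convergent convergent_def by blast
  have S: "f \<in> dom S \<and> S \<cdot> f = g" by (rule closed_opD[OF S.closed uS(1) u(2) g])
  have "(\<lambda>n. norm (S \<cdot> u n)) \<longlonglongrightarrow> norm g" "(\<lambda>n. norm (A \<cdot> u n)) \<longlonglongrightarrow> norm (A \<cdot> f)"
    by (intro tendsto_intros g u)+
  then show ?thesis using S n[OF u(1)] by (auto intro: LIMSEQ_unique)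
qed

section \<open>Nonnegative self-adjoint operators and uniqueness of the square root\<close>

lemma selfadjoint_closed_dense: "selfadjoint_op S \<Longrightarrow> closed_dense_op S"
  unfolding selfadjoint_op_def closed_dense_op_def by (metis closed_op_adj)

text \<open>The form at y + t D y is a nonnegative quadratic in t without constant term, so its
  linear coefficient 2 |D y|^2 vanishes.\<close>

lemma nonneg_form_zero_imp_zero:
  assumes "linear D" and sym: "\<And>x y. inner (D x) y = inner x (D y)"
    and nonneg: "\<And>x. 0 \<le> inner x (D x)" and z: "inner y (D y) = 0"
  shows "D y = 0"
proof -
  have "0 \<le> t * (2 * inner (D y) (D y)) + t\<^sup>2 * inner (D y) (D (D y))" for t
    using nonneg[of "y + t *\<^sub>R D y"] z sym[of y "D y"]
    by (simp add: linear_add[OF assms(1)] linear_scale[OF assms(1)] inner_add_left inner_add_right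
        power2_eq_square inner_commute algebra_simps)
  from quadratic_nonneg_imp_zero[OF this] show ?thesis by simp
qed

locale nonneg_selfadjoint =
  fixes S :: "'a::chilbert_space \<rightharpoonup> 'a"
  assumes nonneg_sa: "nonneg_selfadjoint_op S"
begin

sublocale closed_dense_op S
  using nonneg_sa selfadjoint_closed_dense nonneg_selfadjoint_op_def by blast

lemma adj_S [simp]: "adj S = S"
  using nonneg_sa by (simp add: nonneg_selfadjoint_op_def selfadjoint_op_def)

lemma S_sym: "f \<in> dom S \<Longrightarrow> g \<in> dom S \<Longrightarrow> inner (S \<cdot> f) g = inner f (S \<cdot> g)"
  using inner_adj[OF lin dense, of f g] by simp

lemma S_nonneg: "f \<in> dom S \<Longrightarrow> 0 \<le> inner f (S \<cdot> f)"
  using nonneg_sa by (simp add: nonneg_selfadjoint_op_def Re_cinner)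

lemma dom_S_S: "f \<in> dom (S \<circ>\<^sub>m S) \<longleftrightarrow> f \<in> dom S \<and> S \<cdot> f \<in> dom S"
  by (rule dom_map_comp_iff)

lemma B_dom: "inv_one_plus (S \<circ>\<^sub>m S) g \<in> dom S" "S \<cdot> inv_one_plus (S \<circ>\<^sub>m S) g \<in> dom S"
  "S \<cdot> (S \<cdot> inv_one_plus (S \<circ>\<^sub>m S) g) = g - inv_one_plus (S \<circ>\<^sub>m S) g"
  using B(1)[of g] T_B[of g] by (simp_all add: dom_S_S app_map_comp)

text \<open>With w the resolvent at f, S (S w) = f - w lies in \<open>dom S\<close>. Applying S once
  more shows that S w solves the resolvent equation for S f.\<close>

lemma B_S:
  assumes f: "f \<in> dom S"
  shows "inv_one_plus (S \<circ>\<^sub>m S) (S \<cdot> f) = S \<cdot> inv_one_plus (S \<circ>\<^sub>m S) f"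
proof -
  let ?w = "inv_one_plus (S \<circ>\<^sub>m S) f"
  have "S \<cdot> (S \<cdot> ?w) \<in> dom S \<and> S \<cdot> (S \<cdot> (S \<cdot> ?w)) = S \<cdot> f - S \<cdot> ?w"
    using linear_op_diff[OF lin f B_dom(1)[of f]] by (simp add: B_dom)
  then show ?thesis
    using B_unique[of "S \<cdot> ?w"] B_dom(2)[of f] by (simp add: dom_S_S app_map_comp)
qed

text \<open>The bounded operator S (1 + S^2)^-1. It replaces S in algebraic arguments and still
  determines S on the domain of S^2, every vector of which is a value of the resolvent.\<close>

definition SB :: "'a \<Rightarrow> 'a" where "SB g = S \<cdot> inv_one_plus (S \<circ>\<^sub>m S) g"

lemma bounded_linear_SB: "bounded_linear SB"
proof (rule bounded_linear_intro[of _ 1])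
  show "SB (x + y) = SB x + SB y" for x y
    using B_add[of x y] linear_op_add[OF lin B_dom(1) B_dom(1)] by (simp add: SB_def)
  show "SB (r *\<^sub>R x) = r *\<^sub>R SB x" for r x
    using linear_scale[OF linear_B, of r x] linear_op_scaleR[OF lin B_dom(1)] by (simp add: SB_def)
  show "norm (SB x) \<le> norm x * 1" for x using norm_A_B[of x] by (simp add: SB_def)
qed

text \<open>The decomposition y = B y + S (S (B y)) leaves only terms to which the symmetry of S on
  its domain applies; nonnegativity below uses the same decomposition.\<close>

lemma SB_sym: "inner (SB x) y = inner x (SB y)"
proof -
  let ?B = "inv_one_plus (S \<circ>\<^sub>m S)"
  have "inner (SB x) y = inner (SB x) (?B y) + inner (SB x) (S \<cdot> SB y)"
    by (simp add: SB_def B_dom inner_diff_right)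
  also have "inner (SB x) (?B y) = inner (?B x) (SB y)" by (simp add: SB_def S_sym B_dom)
  also have "inner (SB x) (S \<cdot> SB y) = inner (S \<cdot> SB x) (SB y)"
    by (simp add: SB_def S_sym B_dom(1,2))
  also have "inner (?B x) (SB y) + inner (S \<cdot> SB x) (SB y) = inner x (SB y)"
    by (simp add: SB_def B_dom inner_diff_left)
  finally show ?thesis .
qed

lemma SB_nonneg: "0 \<le> inner x (SB x)"
proof -
  let ?B = "inv_one_plus (S \<circ>\<^sub>m S)"
  have "inner x (SB x) = inner (?B x) (SB x) + inner (S \<cdot> SB x) (SB x)"
    by (simp add: SB_def B_dom inner_diff_left)
  then show ?thesis using S_nonneg[of "?B x"] S_nonneg[of "SB x"]
    by (simp add: SB_def B_dom(1,2) inner_commute)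
qed

lemma B_SB: "inv_one_plus (S \<circ>\<^sub>m S) (SB x) = SB (inv_one_plus (S \<circ>\<^sub>m S) x)"
  by (simp add: SB_def B_S B_dom)

text \<open>The right-hand side depends on S only through S^2, so two roots of one operator have the
  same squared \<open>SB\<close>.\<close>

lemma SB_SB: "SB (SB x) = inv_one_plus (S \<circ>\<^sub>m S) (x - inv_one_plus (S \<circ>\<^sub>m S) x)"
  unfolding SB_def by (simp add: B_S[symmetric] B_dom)

end

text \<open>Let C and C' be the two \<open>SB\<close> operators. They commute and have equal
  squares, so y = (C - C') x satisfies (C + C') y = 0. Nonnegativity forces C y = C' y = 0, and then
  |y|^2 = ((C - C') y, x) = 0.\<close>

lemma nonneg_sqrt_unique:
  assumes "nonneg_selfadjoint_op S" "nonneg_selfadjoint_op S'" and eq: "S \<circ>\<^sub>m S = S' \<circ>\<^sub>m S'"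
    and com: "\<And>x. nonneg_selfadjoint.SB S (nonneg_selfadjoint.SB S' x)
      = nonneg_selfadjoint.SB S' (nonneg_selfadjoint.SB S x)"
  shows "S = S'"
proof -
  interpret S: nonneg_selfadjoint S by unfold_locales fact
  interpret S': nonneg_selfadjoint S' by unfold_locales fact
  interpret D: bounded_linear S.SB by (rule S.bounded_linear_SB)
  interpret D': bounded_linear S'.SB by (rule S'.bounded_linear_SB)
  have SB: "S.SB x = S'.SB x" for x
  proof -
    define y where "y = S.SB x - S'.SB x"
    have "S.SB y + S'.SB y = 0"
      by (simp add: y_def D.diff D'.diff com S.SB_SB S'.SB_SB eq)
    then have "inner y (S.SB y) + inner y (S'.SB y) = 0" by (metis inner_add_right inner_zero_right)
    then have "inner y (S.SB y) = 0" "inner y (S'.SB y) = 0"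
      using S.SB_nonneg[of y] S'.SB_nonneg[of y] by auto
    then have "S.SB y = 0" "S'.SB y = 0"
      by (simp_all add: nonneg_form_zero_imp_zero[OF D.linear S.SB_sym S.SB_nonneg]
          nonneg_form_zero_imp_zero[OF D'.linear S'.SB_sym S'.SB_nonneg])
    moreover have "inner y y = inner (S.SB y - S'.SB y) x"
      by (subst (2) y_def) (simp add: inner_diff S.SB_sym S'.SB_sym)
    ultimately show ?thesis by (simp add: y_def)
  qed
  \<comment> \<open>The domain of the square is a core of each root, so agreement there spreads to
    the whole domain; used twice with the roles of \<open>S\<close> and \<open>S'\<close>
    exchanged.\<close>
  have sub: "S1 \<subseteq>\<^sub>m S2"
    if S1: "closed_dense_op S1" "adj S1 = S1" and S2: "closed_dense_op S2" and T: "S1 \<circ>\<^sub>m S1 = S \<circ>\<^sub>m S"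
      and agree: "\<And>v. v \<in> dom (S \<circ>\<^sub>m S) \<Longrightarrow> v \<in> dom S2 \<and> S1 \<cdot> v = S2 \<cdot> v" for S1 S2 :: "'a \<rightharpoonup> 'a"
  proof -
    interpret S1: closed_dense_op S1 by fact
    interpret S2: closed_dense_op S2 by fact
    have "S2 f = S1 f" if f: "f \<in> dom S1" for f
    proof -
      obtain u where u: "\<And>n. u n \<in> dom (S \<circ>\<^sub>m S)" "u \<longlonglongrightarrow> f" "(\<lambda>n. S1 \<cdot> u n) \<longlonglongrightarrow> S1 \<cdot> f"
        using S1.dom_T_core[OF f] S1(2) T by auto
      have "f \<in> dom S2 \<and> S2 \<cdot> f = S1 \<cdot> f"
        using agree[OF u(1)] u by (intro closed_opD[OF S2.closed]) auto
      then show ?thesis using f by auto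
    qed
    then show ?thesis by (simp add: map_le_def)
  qed
  \<comment> \<open>A vector v in the domain of the square is the resolvent of v + S (S v), so
    \<open>SB\<close> at that vector is S v.\<close>
  have agree: "S \<cdot> v = S' \<cdot> v" if v: "v \<in> dom (S \<circ>\<^sub>m S)" for v
    using SB S.B_unique[of v] v unfolding S.SB_def S'.SB_def eq[symmetric] by (metis S.adj_S)
  show ?thesis
  proof (rule map_le_antisym)
    show "S \<subseteq>\<^sub>m S'"
      using agree S'.dom_S_S eq
      by (intro sub) (auto intro: S.closed_dense_op_axioms S'.closed_dense_op_axioms)
    show "S' \<subseteq>\<^sub>m S"
      using agree S.dom_S_S eq
      by (intro sub) (auto intro: S.closed_dense_op_axioms S'.closed_dense_op_axioms)
  qed
qed

text \<open>With \<open>E = B\<^sup>1\<^sup>/\<^sup>2\<close> and \<open>F = (1 - B)\<^sup>1\<^sup>/\<^sup>2\<close> for \<open>B = (1 + A\<^sup>* A)\<^sup>-\<^sup>1\<close>, the square root of \<open>A\<^sup>* A\<close> has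
  the graph \<open>{(E x, F x) | x}\<close>.\<close>

lemma (in closed_dense_op) nonneg_sqrt_T:
  "\<exists>S. nonneg_selfadjoint_op S \<and> S \<circ>\<^sub>m S = T \<and>
    (\<forall>S'. nonneg_selfadjoint_op S' \<and> S' \<circ>\<^sub>m S' = T \<longrightarrow> S' = S)"
proof -
  have blB: "bounded_linear B"
    using norm_B by (intro bounded_linear_intro[of _ 1]) (auto simp: linear_add linear_scale linear_B)
  have linC: "linear (\<lambda>x. x - B x)" by (intro linear_compose_sub linear_ident linear_B)
  have symC: "inner (x - B x) y = inner x (y - B y)" for x y by (simp add: inner_diff B_sym)
  \<comment> \<open>\<open>nonneg_sqrt_exists\<close> returns a root of 1 - X: X = 1 - B gives E,
    and X = B gives F.\<close>
  obtain E where E: "bounded_linear E" "\<And>x. E (E x) = x - (x - B x)"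
    "\<And>x y. inner (E x) y = inner x (E y)" "\<And>x. 0 \<le> inner x (E x)" "\<And>x. norm (x - E x) \<le> norm x"
    "\<forall>L. bounded_linear L \<longrightarrow> (\<forall>x. L (x - B x) = L x - B (L x)) \<longrightarrow> (\<forall>x. L (E x) = E (L x))"
    by (rule nonneg_sqrt_exists[OF linC norm_id_minus_B symC]) (rule that)
  obtain F where F: "bounded_linear F" "\<And>x. F (F x) = x - B x"
    "\<And>x y. inner (F x) y = inner x (F y)" "\<And>x. 0 \<le> inner x (F x)"
    "\<forall>L. bounded_linear L \<longrightarrow> (\<forall>x. L (B x) = B (L x)) \<longrightarrow> (\<forall>x. L (F x) = F (L x))"
    by (rule nonneg_sqrt_exists[OF linear_B norm_B B_sym]) (rule that)
  interpret E: bounded_linear E by fact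
  interpret F: bounded_linear F by fact
  have EE: "E (E x) = B x" for x using E(2) by simp
  have E_com: "L (E x) = E (L x)" if L: "bounded_linear L" and "\<And>x. L (B x) = B (L x)" for L x
    using that bounded_linear.linear[OF L] by (intro E(6)[rule_format]) (simp_all add: linear_diff)
  have EB: "E (B x) = B (E x)" for x by (rule E_com[OF blB, symmetric]) simp
  have EF: "E (F x) = F (E x)" for x by (rule F(5)[rule_format, OF E(1) EB])
  have Einj: "E x = E y \<longleftrightarrow> x = y" for x y
  proof
    assume "E x = E y"
    then have "B x = B y" by (metis EE)
    then show "x = y" by (metis B(2))
  qed simp
  have scaleE: "E (c *\<^sub>C x) = c *\<^sub>C E x" and scaleF: "F (c *\<^sub>C x) = c *\<^sub>C F x" for c x
    using E_com[OF bounded_linear_scaleC] F(5)[rule_format, OF bounded_linear_scaleC] B_scaleC by auto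
  \<comment> \<open>A product of commuting nonnegative operators is nonnegative: with H a root of E
    that commutes with F, (x, F E x) = (H x, F H x). The bound |x - E x| \<le> |x| is what lets E
    itself be fed to the root construction, with X = 1 - E.\<close>
  have EF_nonneg: "0 \<le> inner x (F (E x))" for x
  proof -
    have lin': "linear (\<lambda>x. x - E x)" by (intro linear_compose_sub linear_ident E.linear)
    have s': "inner (x - E x) y = inner x (y - E y)" for x y by (simp add: inner_diff E(3))
    obtain H where H: "\<And>x. H (H x) = x - (x - E x)" "\<And>x y. inner (H x) y = inner x (H y)"
      "\<forall>L. bounded_linear L \<longrightarrow> (\<forall>x. L (x - E x) = L x - E (L x)) \<longrightarrow> (\<forall>x. L (H x) = H (L x))"
      by (rule nonneg_sqrt_exists[OF lin' E(5) s']) (rule that)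
    have "F (E x) = H (H (F x))" by (simp add: H(1) EF)
    also have "\<dots> = H (F (H x))" using H(3)[rule_format, OF F(1), of x] by (simp add: F.diff EF)
    finally show ?thesis using F(4)[of "H x"] by (simp add: H(2)[symmetric])
  qed
  define S where "S f = (if f \<in> range E then Some (F (inv E f)) else None)" for f
  have S_E: "S (E x) = Some (F x)" for x using Einj by (simp add: S_def inv_f_f inj_def)
  have dom_S: "dom S = range E" by (auto simp: S_def dom_def)
  have S_iff: "S f = Some h \<longleftrightarrow> (\<exists>x. f = E x \<and> h = F x)" for f h
    using S_E by (auto simp: S_def split: if_splits)
  have linS: "linear_op S"
    unfolding linear_op_def dom_S
  proof (intro conjI ballI allI)
    show "0 \<in> range E" using E.zero by (metis rangeI)
    fix f g c assume "f \<in> range E" "g \<in> range E"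
    then obtain x y where xy: "f = E x" "g = E y" by auto
    have a: "f + g = E (x + y)" "c *\<^sub>C f = E (c *\<^sub>C x)" by (simp_all add: xy E.add scaleE)
    show "f + g \<in> range E" "S \<cdot> (f + g) = S \<cdot> f + S \<cdot> g"
      unfolding a by (simp_all add: S_E xy F.add)
  next
    fix f c assume "f \<in> range E"
    then obtain x where x: "f = E x" by auto
    have a: "c *\<^sub>C f = E (c *\<^sub>C x)" by (simp add: x scaleE)
    show "c *\<^sub>C f \<in> range E" "S \<cdot> (c *\<^sub>C f) = c *\<^sub>C (S \<cdot> f)"
      unfolding a by (simp_all add: S_E x scaleF)
  qed
  have denseS: "densely_defined S"
    unfolding densely_defined_def
  proof (rule closure_eq_UNIV_if_no_orthogonal[OF subspace_dom[OF linS]])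
    fix y assume "\<And>v. v \<in> dom S \<Longrightarrow> inner y v = 0"
    then have "inner (E y) (E y) = 0" by (metis E(3) dom_S rangeI)
    then show "y = 0" using Einj[of y 0] by (simp add: E.zero)
  qed
  have adjS: "adj S = S"
  proof (rule map_eq_if_same_graph)
    fix g h
    have "adj S g = Some h \<longleftrightarrow> (\<forall>x. inner (F g) x = inner (E h) x)"
      unfolding adj_eq_Some_iff[OF linS denseS] dom_S by (simp add: S_E E(3) F(3))
    also have "\<dots> \<longleftrightarrow> F g = E h" by (metis vector_eq_rdot)
    also have "\<dots> \<longleftrightarrow> S g = Some h"
    proof
      assume *: "F g = E h"
      \<comment> \<open>E^2 + F^2 = 1 supplies the parameter: if (g, h) = (E x, F x), then x = E g +
        F h. Together with F g = E h, this x reproduces both components.\<close>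
      have "g = E (E g + F h)" "h = F (E g + F h)"
        using F(2)[of g] F(2)[of h] by (simp_all add: E.add F.add EE EF * flip: EF)
      then show "S g = Some h" unfolding S_iff by blast
    qed (auto simp: S_iff EF)
    finally show "adj S g = Some h \<longleftrightarrow> S g = Some h" .
  qed
  have nn: "nonneg_selfadjoint_op S"
    unfolding nonneg_selfadjoint_op_def selfadjoint_op_def
  proof (intro conjI ballI linS denseS adjS)
    fix f assume "f \<in> dom S"
    then obtain x where x: "f = E x" using dom_S by auto
    show "0 \<le> Re (cinner f (S \<cdot> f))"
      using EF_nonneg[of x] by (simp add: x Re_cinner S_E E(3) EF)
  qed
  have SS: "S \<circ>\<^sub>m S = T"
  proof (rule map_eq_if_same_graph)
    fix f h
    have "(S \<circ>\<^sub>m S) f = Some h \<longleftrightarrow> (\<exists>x y. f = E x \<and> F x = E y \<and> h = F y)"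
      by (auto simp: map_comp_Some_iff S_iff)
    also have "\<dots> \<longleftrightarrow> f = B (f + h)"
    proof
      assume "\<exists>x y. f = E x \<and> F x = E y \<and> h = F y"
      then obtain x y where xy: "f = E x" "F x = E y" "h = F y" by blast
      have "x = E (E x) + F (F x)" by (simp add: EE F(2))
      also have "\<dots> = E (f + h)" by (simp add: xy E.add EF)
      finally have "x = E (f + h)" .
      from arg_cong[OF this, of E] show "f = B (f + h)" by (simp only: xy(1)[symmetric] EE)
    next
      assume "f = B (f + h)"
      then have "f = E (E (f + h))" "F (E (f + h)) = E (F (f + h))" "h = F (F (f + h))"
        by (simp_all add: EE EF F(2))
      then show "\<exists>x y. f = E x \<and> F x = E y \<and> h = F y" by blast
    qed
    also have "\<dots> \<longleftrightarrow> T f = Some h"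
    proof
      assume *: "f = B (f + h)"
      then have "f \<in> dom T" using B(1) by metis
      moreover have "T \<cdot> f = h" using T_B[of "f + h"] * by simp
      ultimately show "T f = Some h" by auto
    next
      assume "T f = Some h"
      then show "f = B (f + h)" using B_unique[OF domI, of f h] by simp
    qed
    finally show "(S \<circ>\<^sub>m S) f = Some h \<longleftrightarrow> T f = Some h" .
  qed
  \<comment> \<open>The \<open>SB\<close> operator of any rival root commutes with B, hence with E
    and F, hence with F E, which is the \<open>SB\<close> operator of the constructed root.\<close>
  have "S' = S" if S': "nonneg_selfadjoint_op S'" "S' \<circ>\<^sub>m S' = T" for S'
  proof (rule nonneg_sqrt_unique[OF S'(1) nn])
    interpret S: nonneg_selfadjoint S by unfold_locales fact
    interpret S': nonneg_selfadjoint S' by unfold_locales fact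
    show "S' \<circ>\<^sub>m S' = S \<circ>\<^sub>m S" using SS S' by simp
    have SB: "S.SB x = F (E x)" for x
      unfolding S.SB_def SS using EE[of x] S_E[of "E x"] by simp
    have com: "S'.SB (B x) = B (S'.SB x)" for x using S'.B_SB[of x] by (simp add: S'(2))
    show "S'.SB (S.SB x) = S.SB (S'.SB x)" for x
      unfolding SB using F(5)[rule_format, OF S'.bounded_linear_SB com] E_com[OF S'.bounded_linear_SB com] by simp
  qed
  then show ?thesis using nn SS by blast
qed

lemma (in closed_dense_op) abs_op:
  "nonneg_selfadjoint_op (abs_op A)" "abs_op A \<circ>\<^sub>m abs_op A = T"
proof -
  have "\<exists>!S. nonneg_selfadjoint_op S \<and> S \<circ>\<^sub>m S = T" using nonneg_sqrt_T by blast
  from theI'[OF this] show "nonneg_selfadjoint_op (abs_op A)" "abs_op A \<circ>\<^sub>m abs_op A = T"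
    by (auto simp: abs_op_def sqrt_op_def)
qed

text \<open>A and \<open>|A|\<close> are closed with the same T, so the comparison of domains
  applies in both directions. This reconciles \<open>Q_op\<close>, defined on
  \<open>dom |A|\<close>, with \<open>G_op\<close> and \<open>J\<close>, defined through
  \<open>dom A\<close>.\<close>

lemma (in closed_dense_op) dom_abs_op: "dom (abs_op A) = dom A"
  and norm_abs_op: "f \<in> dom A \<Longrightarrow> norm (abs_op A \<cdot> f) = norm (A \<cdot> f)"
proof -
  interpret S: nonneg_selfadjoint "abs_op A" by unfold_locales (rule abs_op)
  have eq: "T = adj (abs_op A) \<circ>\<^sub>m abs_op A" using abs_op(2) by simp
  show "dom (abs_op A) = dom A"
    using dom_subset_if_same_square[OF closed_dense_op_axioms S.closed_dense_op_axioms eq]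
      dom_subset_if_same_square[OF S.closed_dense_op_axioms closed_dense_op_axioms eq[symmetric]]
    by blast
  show "f \<in> dom A \<Longrightarrow> norm (abs_op A \<cdot> f) = norm (A \<cdot> f)"
    using dom_subset_if_same_square[OF closed_dense_op_axioms S.closed_dense_op_axioms eq] by blast
qed

section \<open>Contraction semigroups\<close>

lemma continuous_maps_agree_on_dense:
  fixes f g :: "'a::topological_space \<Rightarrow> 'b::t2_space"
  assumes "continuous_on UNIV f" "continuous_on UNIV g" "closure D = UNIV"
    and "\<And>x. x \<in> D \<Longrightarrow> f x = g x"
  shows "f x = g x"
proof -
  have "closure D \<subseteq> {x. f x = g x}"
    using assms by (intro closure_minimal closed_Collect_eq) auto
  then show ?thesis using assms(3) by auto
qed

lemma continuous_on_linear_contraction: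
  fixes T :: "'a::real_normed_vector \<Rightarrow> 'b::real_normed_vector"
  assumes "linear T" "\<And>x. norm (T x) \<le> norm x"
  shows "continuous_on UNIV T"
proof -
  have "bounded_linear T"
    using assms by (intro bounded_linear_intro[of _ 1]) (auto simp: linear_add linear_scale)
  then show ?thesis by (simp add: linear_continuous_on)
qed

lemma convergent_if_geometric_increments:
  fixes a :: "nat \<Rightarrow> 'a::{real_normed_vector,complete_space}"
  assumes "\<And>k. norm (a (Suc k) - a k) \<le> C * (1/2)^k"
  shows "convergent a"
proof -
  have "summable (\<lambda>k. C * (1/2::real)^k)" by (intro summable_mult summable_geometric) simp
  then have "Cauchy (\<lambda>n. \<Sum>k<n. C * (1/2::real)^k)"
    by (simp only: summable_iff_convergent Cauchy_convergent_iff)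
  moreover have "norm (a m - a n) \<le> (\<Sum>k<m. C * (1/2::real)^k) - (\<Sum>k<n. C * (1/2::real)^k)"
    if "n \<le> m" for m n
    using that
  proof (induction m rule: dec_induct)
    case (step m)
    then show ?case using assms[of m] norm_triangle_ineq[of "a (Suc m) - a m" "a m - a n"] by simp
  qed simp
  ultimately have "Cauchy a"
    unfolding Cauchy_def dist_norm
  proof (intro allI impI)
    let ?s = "\<lambda>n. \<Sum>k<n. C * (1/2::real)^k"
    fix e :: real
    assume *: "\<forall>e>0. \<exists>M. \<forall>m\<ge>M. \<forall>n\<ge>M. norm (?s m - ?s n) < e" and "e > 0"
    then obtain M where M: "\<forall>m\<ge>M. \<forall>n\<ge>M. norm (?s m - ?s n) < e" by blast
    assume **: "\<And>n m. n \<le> m \<Longrightarrow> norm (a m - a n) \<le> ?s m - ?s n"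
    have "norm (a m - a n) < e" if "m \<ge> M" "n \<ge> M" for m n
    proof (cases "n \<le> m")
      case True
      then show ?thesis using **[OF True] M[rule_format, OF that] unfolding real_norm_def by linarith
    next
      case False
      then have "n \<ge> m" by simp
      then show ?thesis using **[of m n] M[rule_format, OF that(2,1)]
        unfolding real_norm_def norm_minus_commute[of "a m"] by linarith
    qed
    then show "\<exists>M. \<forall>m\<ge>M. \<forall>n\<ge>M. norm (a m - a n) < e" by blast
  qed
  then show ?thesis by (rule Cauchy_convergent)
qed

text \<open>In the three-term split, contractivity controls the outer terms uniformly in k; only the
  middle term uses convergence on D.\<close>

lemma convergent_on_dense_imp_convergent:
  fixes T :: "nat \<Rightarrow> 'a::real_normed_vector \<Rightarrow> 'b::{real_normed_vector,complete_space}"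
  assumes lin: "\<And>k. linear (T k)" and contr: "\<And>k x. norm (T k x) \<le> norm x"
    and dense: "closure D = UNIV" and conv: "\<And>x. x \<in> D \<Longrightarrow> convergent (\<lambda>k. T k x)"
  shows "convergent (\<lambda>k. T k x)"
proof -
  have "Cauchy (\<lambda>k. T k x)"
  proof (rule CauchyI)
    fix e :: real assume e: "e > 0"
    obtain y where y: "y \<in> D" "norm (x - y) < e / 3"
      using dense e closure_approachable[of x D]
      by (metis UNIV_I dist_norm norm_minus_commute zero_less_divide_iff zero_less_numeral)
    then obtain M where M: "\<forall>m\<ge>M. \<forall>n\<ge>M. norm (T m y - T n y) < e / 3"
      using CauchyD[OF convergent_Cauchy[OF conv[OF y(1)]], of "e/3"] e by auto
    have "norm (T m x - T n x) < e" if "m \<ge> M" "n \<ge> M" for m n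
    proof -
      have "T m x - T n x = T m (x - y) + (T m y - T n y) + T n (y - x)"
        by (simp add: linear_diff[OF lin])
      also have "norm \<dots> \<le> norm (T m (x - y)) + norm (T m y - T n y) + norm (T n (y - x))"
        by (intro norm_triangle_le add_mono norm_triangle_ineq order_refl)
      also have "\<dots> < e / 3 + e / 3 + e / 3"
        using contr[of m "x - y"] contr[of n "y - x"] y(2) M that
        by (intro add_strict_mono) (auto simp: norm_minus_commute intro: le_less_trans)
      finally show ?thesis by simp
    qed
    then show "\<exists>M. \<forall>m\<ge>M. \<forall>n\<ge>M. norm (T m x - T n x) < e" by blast
  qed
  then show ?thesis by (simp add: Cauchy_convergent_iff)
qed

section \<open>The implicit Euler scheme on dyadic time grids\<close>

definition dyadic_steps :: "nat \<Rightarrow> real \<Rightarrow> nat" where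
  "dyadic_steps k t = nat \<lfloor>t * 2^k\<rfloor>"

lemma dyadic_steps_bounds:
  assumes "0 \<le> t"
  shows "real (dyadic_steps k t) \<le> t * 2^k" "t * 2^k < real (dyadic_steps k t) + 1"
proof -
  have "0 \<le> \<lfloor>t * 2^k\<rfloor>" using assms by simp
  then show "real (dyadic_steps k t) \<le> t * 2^k" "t * 2^k < real (dyadic_steps k t) + 1"
    unfolding dyadic_steps_def by linarith+
qed

lemma dyadic_steps_mult_le:
  assumes "0 \<le> t" shows "real (dyadic_steps k t) * (1/2)^k \<le> t"
  using dyadic_steps_bounds(1)[OF assms, of k] by (simp add: power_one_over divide_simps algebra_simps)

lemma dyadic_steps_mult_gt:
  assumes "0 \<le> t" shows "t - (1/2)^k < real (dyadic_steps k t) * (1/2)^k"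
proof -
  have "t = t * 2^k * (1/2)^k" by (simp add: power_one_over)
  also have "\<dots> < (real (dyadic_steps k t) + 1) * (1/2)^k"
    by (intro mult_strict_right_mono dyadic_steps_bounds assms) simp
  finally show ?thesis by (simp add: algebra_simps)
qed

text \<open>Halving the step size doubles the number of steps up to one leftover step, so
  consecutive levels can be compared step by step.\<close>

lemma dyadic_steps_Suc:
  assumes "0 \<le> t"
  shows "2 * dyadic_steps k t \<le> dyadic_steps (Suc k) t"
    and "dyadic_steps (Suc k) t \<le> 2 * dyadic_steps k t + 1"
proof -
  have "t * 2 ^ Suc k = 2 * (t * 2^k)" by simp
  then have "real (2 * dyadic_steps k t) < real (dyadic_steps (Suc k) t) + 1"
    "real (dyadic_steps (Suc k) t) < real (2 * dyadic_steps k t) + 2"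
    using dyadic_steps_bounds[OF assms, of k] dyadic_steps_bounds[OF assms, of "Suc k"]
    by linarith+
  then show "2 * dyadic_steps k t \<le> dyadic_steps (Suc k) t"
    "dyadic_steps (Suc k) t \<le> 2 * dyadic_steps k t + 1" by linarith+
qed

lemma dyadic_steps_add:
  assumes "0 \<le> s" "0 \<le> t"
  shows "dyadic_steps k s + dyadic_steps k t \<le> dyadic_steps k (s + t)"
    and "dyadic_steps k (s + t) \<le> dyadic_steps k s + dyadic_steps k t + 1"
proof -
  have "(s + t) * 2 ^ k = s * 2 ^ k + t * 2 ^ k" by (simp add: algebra_simps)
  then have "real (dyadic_steps k s + dyadic_steps k t) < real (dyadic_steps k (s + t)) + 1"
    "real (dyadic_steps k (s + t)) < real (dyadic_steps k s + dyadic_steps k t) + 2"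
    using dyadic_steps_bounds[of s k] dyadic_steps_bounds[of t k] dyadic_steps_bounds[of "s + t" k]
      assms by simp_all
  then show "dyadic_steps k s + dyadic_steps k t \<le> dyadic_steps k (s + t)"
    "dyadic_steps k (s + t) \<le> dyadic_steps k s + dyadic_steps k t + 1" by linarith+
qed

text \<open>\<open>K h\<close> stands for (1 - h G)^-1. G is a total function whose values matter
  only on D, and the scalars are real, which keeps the estimates free of partial functions and
  complex structure.\<close>

locale contractive_resolvents =
  fixes D :: "'a::{real_normed_vector,complete_space} set" and G :: "'a \<Rightarrow> 'a"
    and K :: "real \<Rightarrow> 'a \<Rightarrow> 'a"
  assumes D: "subspace D" and dense: "closure D = UNIV"
    and G_add: "\<And>f g. f \<in> D \<Longrightarrow> g \<in> D \<Longrightarrow> G (f + g) = G f + G g"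
    and G_scale: "\<And>c f. f \<in> D \<Longrightarrow> G (c *\<^sub>R f) = c *\<^sub>R G f"
    and K_linear: "\<And>h. h > 0 \<Longrightarrow> linear (K h)"
    and K_contr: "\<And>h f. h > 0 \<Longrightarrow> norm (K h f) \<le> norm f"
    and K_D: "\<And>h f. h > 0 \<Longrightarrow> K h f \<in> D"
    and K_right: "\<And>h f. h > 0 \<Longrightarrow> K h f - h *\<^sub>R G (K h f) = f"
    and K_left: "\<And>h f. h > 0 \<Longrightarrow> f \<in> D \<Longrightarrow> K h (f - h *\<^sub>R G f) = f"
begin

lemma G_diff: "f \<in> D \<Longrightarrow> g \<in> D \<Longrightarrow> G (f - g) = G f - G g"
  using G_add[of f "- 1 *\<^sub>R g"] G_scale[of g "-1"] subspace_scale[OF D, of g "-1"] by simp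

lemma G_K:
  assumes "h > 0" "f \<in> D"
  shows "G (K h f) = K h (G f)"
proof -
  have "K h f - h *\<^sub>R K h (G f) = f"
    using K_left[OF assms] by (simp add: linear_diff[OF K_linear] linear_scale[OF K_linear] assms)
  with K_right[of h f] assms have "h *\<^sub>R G (K h f) = h *\<^sub>R K h (G f)"
    by (metis diff_diff_eq2 diff_add_cancel add_diff_cancel_left')
  then show ?thesis using assms by simp
qed

lemma linear_K_pow: "h > 0 \<Longrightarrow> linear (K h ^^ n)"
  by (induction n) (auto intro: linear_compose K_linear simp: linear_id[unfolded id_def] id_def)

lemma norm_K_pow: "h > 0 \<Longrightarrow> norm ((K h ^^ n) f) \<le> norm f"
  by (induction n) (auto intro: order_trans[OF K_contr])

lemma K_pow_D: "h > 0 \<Longrightarrow> f \<in> D \<Longrightarrow> (K h ^^ n) f \<in> D"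
  by (cases n) (auto intro: K_D)

lemma G_K_pow: "h > 0 \<Longrightarrow> f \<in> D \<Longrightarrow> G ((K h ^^ n) f) = (K h ^^ n) (G f)"
  by (induction n) (auto simp: G_K K_pow_D)

lemma K_minus_id:
  assumes "h > 0" "f \<in> D"
  shows "K h f - f = h *\<^sub>R K h (G f)"
  using K_right[of h f] G_K[of h f] assms by (metis add_diff_cancel_left' diff_add_cancel)

lemma norm_K_pow_minus_id:
  assumes "h > 0" "f \<in> D"
  shows "norm ((K h ^^ n) f - f) \<le> real n * h * norm (G f)"
proof (induction n)
  case (Suc n)
  have "norm (K h ((K h ^^ n) f) - (K h ^^ n) f) \<le> h * norm (G f)"
    using assms K_minus_id[of h "(K h ^^ n) f"] K_contr[of h "(K h ^^ n) (G f)"]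
      norm_K_pow[of h n "G f"]
    by (auto simp: K_pow_D G_K_pow intro: mult_left_mono order_trans)
  with Suc norm_triangle_ineq[of "K h ((K h ^^ n) f) - (K h ^^ n) f" "(K h ^^ n) f - f"]
  show ?case by (simp add: algebra_simps)
qed simp

lemma norm_K_pow_diff:
  assumes "h > 0" "f \<in> D" "n \<le> m"
  shows "norm ((K h ^^ m) f - (K h ^^ n) f) \<le> real (m - n) * h * norm (G f)"
proof -
  have "(K h ^^ m) f = (K h ^^ n) ((K h ^^ (m - n)) f)"
    using assms by (metis comp_apply funpow_add le_add_diff_inverse)
  then have "(K h ^^ m) f - (K h ^^ n) f = (K h ^^ n) ((K h ^^ (m - n)) f - f)"
    by (simp add: linear_diff[OF linear_K_pow[OF assms(1)]])
  then show ?thesis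
    using order_trans[OF norm_K_pow[OF assms(1)] norm_K_pow_minus_id[OF assms(1,2)]] by simp
qed

text \<open>For v the result of two half steps, f = (1 - h G / 2)^2 v = (1 - h G) v + (h^2 / 4) G^2
  v. Applying \<open>K h\<close> exhibits the local error as (h^2 / 4) \<open>K h\<close> G^2
  v.\<close>

lemma K_minus_two_half_steps:
  assumes h: "h > 0" and f: "f \<in> D" "G f \<in> D"
  shows "norm (K h f - K (h/2) (K (h/2) f)) \<le> h\<^sup>2 / 4 * norm (G (G f))"
proof -
  let ?L = "K (h/2)"
  have h2: "h / 2 > 0" using h by simp
  define v where "v = ?L (?L f)"
  have vD: "v \<in> D" by (simp add: v_def K_D h)
  have Gv: "G v = ?L (?L (G f))" by (simp add: v_def G_K K_D h f)
  have GvD: "G v \<in> D" by (simp add: Gv K_D h)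
  have GGv: "G (G v) = ?L (?L (G (G f)))" by (simp add: Gv G_K K_D h f)
  have u: "v - (h/2) *\<^sub>R G v = ?L f" using K_right[OF h2, of "?L f"] by (simp add: v_def)
  have "f = ?L f - (h/2) *\<^sub>R G (?L f)" using K_right[OF h2, of f] by simp
  also have "\<dots> = (v - (h/2) *\<^sub>R G v) - (h/2) *\<^sub>R (G v - (h/2) *\<^sub>R G (G v))"
    unfolding u[symmetric] using vD GvD by (simp add: G_diff G_scale subspace_scale[OF D])
  also have "\<dots> = (v - h *\<^sub>R G v) + (h\<^sup>2 / 4) *\<^sub>R G (G v)"
    by (simp add: algebra_simps power2_eq_square flip: scaleR_2 scaleR_add_left)
  finally have "K h f = K h (v - h *\<^sub>R G v) + (h\<^sup>2 / 4) *\<^sub>R K h (G (G v))"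
    using h by (metis K_linear linear_add linear_scale)
  then have "K h f - v = (h\<^sup>2 / 4) *\<^sub>R K h (G (G v))" using K_left[OF h vD] by simp
  moreover have "norm (K h (G (G v))) \<le> norm (G (G f))"
    unfolding GGv using K_contr h h2 by (meson order_trans)
  ultimately show ?thesis unfolding v_def[symmetric] by (simp add: mult_left_mono)
qed

text \<open>Contractivity propagates earlier errors without growth, so the local errors merely add
  up; with n h \<le> t the total is of order h.\<close>

lemma K_pow_minus_half_steps:
  assumes h: "h > 0" and f: "f \<in> D" "G f \<in> D"
  shows "norm ((K h ^^ n) f - (K (h/2) ^^ (2*n)) f) \<le> real n * (h\<^sup>2 / 4 * norm (G (G f)))"
proof (induction n)
  case (Suc n)
  let ?L = "K (h/2)"
  have h2: "h / 2 > 0" using h by simp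
  define w where "w = (?L ^^ (2*n)) f"
  have w: "w \<in> D" "G w \<in> D" "G (G w) = (?L ^^ (2*n)) (G (G f))"
    by (simp_all add: w_def K_pow_D G_K_pow h f)
  have "norm (K h w - ?L (?L w)) \<le> h\<^sup>2 / 4 * norm (G (G f))"
    using K_minus_two_half_steps[OF h w(1,2)] norm_K_pow[OF h2, of "2*n" "G (G f)"]
    unfolding w(3) by (meson mult_left_mono order_trans divide_nonneg_nonneg zero_le_power2 zero_le_numeral)
  moreover have "norm (K h ((K h ^^ n) f - w)) \<le> real n * (h\<^sup>2 / 4 * norm (G (G f)))"
    using order_trans[OF K_contr[OF h] Suc.IH] by (simp add: w_def)
  moreover have eq: "(K h ^^ Suc n) f - (?L ^^ (2 * Suc n)) f
      = K h ((K h ^^ n) f - w) + (K h w - ?L (?L w))"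
    by (simp add: w_def linear_diff[OF K_linear[OF h]])
  moreover have "real (Suc n) * (h\<^sup>2 / 4 * norm (G (G f)))
      = real n * (h\<^sup>2 / 4 * norm (G (G f))) + h\<^sup>2 / 4 * norm (G (G f))"
    by (simp add: algebra_simps)
  ultimately show ?case
    using norm_triangle_ineq[of "K h ((K h ^^ n) f - w)" "K h w - ?L (?L w)"]
    unfolding eq by linarith
qed simp

definition euler_approx :: "nat \<Rightarrow> real \<Rightarrow> 'a \<Rightarrow> 'a" where
  "euler_approx k t = K ((1/2)^k) ^^ dyadic_steps k t"

lemma linear_euler_approx: "linear (euler_approx k t)"
  by (simp add: euler_approx_def linear_K_pow)

lemma norm_euler_approx: "norm (euler_approx k t f) \<le> norm f"
  by (simp add: euler_approx_def norm_K_pow)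

text \<open>The second-order error bound lives on the domain of G^2. That domain is dense because
  \<open>K h\<close> maps D into it and \<open>K h f\<close> tends to f as h tends to 0.\<close>

lemma dense_G_in_D: "closure {f \<in> D. G f \<in> D} = UNIV"
proof -
  let ?E = "{f \<in> D. G f \<in> D}"
  have "D \<subseteq> closure ?E"
  proof
    fix f assume f: "f \<in> D"
    have K: "K (1 / real (Suc n)) f \<in> ?E" for n using f by (simp add: K_D G_K)
    have "(\<lambda>n. K (1 / real (Suc n)) f - f) \<longlonglongrightarrow> 0"
    proof (rule Lim_null_comparison)
      show "\<forall>\<^sub>F n in sequentially. norm (K (1 / real (Suc n)) f - f) \<le> 1 / real (Suc n) * norm (G f)"
      proof (intro always_eventually allI)
        show "norm (K (1 / real (Suc n)) f - f) \<le> 1 / real (Suc n) * norm (G f)" for n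
          using norm_K_pow_minus_id[of "1 / real (Suc n)" f 1] f by simp
      qed
      show "(\<lambda>n. 1 / real (Suc n) * norm (G f)) \<longlonglongrightarrow> 0"
        by (rule tendsto_mult_left_zero[OF LIMSEQ_Suc[OF lim_1_over_n]])
    qed
    then have "(\<lambda>n. K (1 / real (Suc n)) f) \<longlonglongrightarrow> f" by (simp add: LIM_zero_iff)
    then show "f \<in> closure ?E"
      unfolding closure_sequential using K by (intro exI[of _ "\<lambda>n. K (1 / real (Suc n)) f"] conjI) auto
  qed
  then have "closure D \<subseteq> closure ?E" by (simp add: closure_minimal)
  then show ?thesis using dense by auto
qed

text \<open>On the domain of G^2 the leftover step costs at most (h/2) |G f| and the halving at most
  t (h/4) |G (G f)|. With h = 2^-k these increments are geometric; contractivity extends convergence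
  to all f.\<close>

lemma convergent_euler_approx:
  assumes t: "0 \<le> t"
  shows "convergent (\<lambda>k. euler_approx k t f)"
proof (rule convergent_on_dense_imp_convergent[OF linear_euler_approx norm_euler_approx dense_G_in_D])
  fix f assume "f \<in> {f \<in> D. G f \<in> D}"
  then have f: "f \<in> D" "G f \<in> D" by auto
  show "convergent (\<lambda>k. euler_approx k t f)"
  proof (rule convergent_if_geometric_increments)
    fix k
    define h :: real where "h = (1/2)^k"
    define n where "n = dyadic_steps k t"
    define m where "m = dyadic_steps (Suc k) t"
    have h: "h > 0" "h / 2 > 0" "(1/2)^Suc k = h / 2" by (auto simp: h_def)
    have nm: "2 * n \<le> m" "m - 2 * n \<le> 1"
      using dyadic_steps_Suc[OF t, of k] by (auto simp: n_def m_def)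
    have "norm ((K (h/2) ^^ m) f - (K (h/2) ^^ (2*n)) f) \<le> real (m - 2*n) * (h/2) * norm (G f)"
      by (rule norm_K_pow_diff[OF h(2) f(1) nm(1)])
    also have "\<dots> \<le> 1 * (h/2) * norm (G f)" using nm(2) h(1) by (intro mult_right_mono) auto
    finally have a: "norm ((K (h/2) ^^ m) f - (K (h/2) ^^ (2*n)) f) \<le> h/2 * norm (G f)" by simp
    have "real n * (h\<^sup>2 / 4 * norm (G (G f))) = (real n * h) * (h / 4 * norm (G (G f)))"
      by (simp add: power2_eq_square)
    also have "\<dots> \<le> t * (h / 4 * norm (G (G f)))"
      using dyadic_steps_mult_le[OF t, of k] h(1) by (intro mult_right_mono) (auto simp: n_def h_def)
    finally have b: "norm ((K h ^^ n) f - (K (h/2) ^^ (2*n)) f) \<le> t * (h / 4 * norm (G (G f)))"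
      using K_pow_minus_half_steps[OF h(1) f, of n] by linarith
    have "norm (euler_approx (Suc k) t f - euler_approx k t f)
        = norm (((K (h/2) ^^ m) f - (K (h/2) ^^ (2*n)) f) - ((K h ^^ n) f - (K (h/2) ^^ (2*n)) f))"
      unfolding euler_approx_def h(3) by (simp add: h_def n_def m_def)
    also have "\<dots> \<le> h/2 * norm (G f) + t * (h / 4 * norm (G (G f)))"
      using a b norm_triangle_ineq4 by (smt (verit))
    finally show "norm (euler_approx (Suc k) t f - euler_approx k t f)
        \<le> (norm (G f) / 2 + t * norm (G (G f)) / 4) * (1/2)^k"
      by (simp add: h_def algebra_simps)
  qed
qed

definition euler_limit :: "real \<Rightarrow> 'a \<Rightarrow> 'a" where
  "euler_limit t f = lim (\<lambda>k. euler_approx k t f)"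

lemma euler_approx_tendsto:
  "0 \<le> t \<Longrightarrow> (\<lambda>k. euler_approx k t f) \<longlonglongrightarrow> euler_limit t f"
  using convergent_euler_approx by (simp add: euler_limit_def convergent_LIMSEQ_iff)

lemma linear_euler_limit:
  assumes "0 \<le> t" shows "linear (euler_limit t)"
proof (rule linearI)
  show "euler_limit t (f + g) = euler_limit t f + euler_limit t g" for f g
    using tendsto_add[OF euler_approx_tendsto[OF assms, of f] euler_approx_tendsto[OF assms, of g]]
    by (intro LIMSEQ_unique[OF euler_approx_tendsto[OF assms]])
      (simp add: linear_add[OF linear_euler_approx])
  show "euler_limit t (c *\<^sub>R f) = c *\<^sub>R euler_limit t f" for c f
    using tendsto_scaleR[OF tendsto_const euler_approx_tendsto[OF assms, of f], of c]
    by (intro LIMSEQ_unique[OF euler_approx_tendsto[OF assms]])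
      (simp add: linear_scale[OF linear_euler_approx])
qed

lemma norm_euler_limit: "0 \<le> t \<Longrightarrow> norm (euler_limit t f) \<le> norm f"
  by (rule LIMSEQ_le_const2[OF tendsto_norm[OF euler_approx_tendsto]])
    (auto intro: norm_euler_approx)

lemma euler_limit_commute:
  assumes t: "0 \<le> t" and L: "bounded_linear L" and com: "\<And>h f. h > 0 \<Longrightarrow> L (K h f) = K h (L f)"
  shows "L (euler_limit t f) = euler_limit t (L f)"
proof -
  have "L ((K h ^^ n) f) = (K h ^^ n) (L f)" if "h > 0" for h n
    by (induction n) (auto simp: com that)
  then have "L (euler_approx k t f) = euler_approx k t (L f)" for k by (simp add: euler_approx_def)
  then show ?thesis
    using bounded_linear.tendsto[OF L euler_approx_tendsto[OF t, of f]]
      euler_approx_tendsto[OF t, of "L f"]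
    by (auto intro: LIMSEQ_unique)
qed

section \<open>Semigroup law, strong continuity and derivative at zero\<close>

lemma euler_limit_0: "euler_limit 0 f = f"
  by (rule LIMSEQ_unique[OF euler_approx_tendsto]) (simp_all add: euler_approx_def dyadic_steps_def)

lemma norm_euler_limit_diff:
  assumes "0 \<le> s" "s \<le> t" "f \<in> D"
  shows "norm (euler_limit t f - euler_limit s f) \<le> (t - s) * norm (G f)"
proof (rule LIMSEQ_le)
  have t: "0 \<le> t" using assms by simp
  show "(\<lambda>k. norm (euler_approx k t f - euler_approx k s f))
      \<longlonglongrightarrow> norm (euler_limit t f - euler_limit s f)"
    by (intro tendsto_intros euler_approx_tendsto t assms)
  \<comment> \<open>The extra 2^-k pays for rounding s and t down to the grid and disappears in the
    limit.\<close>
  have "(\<lambda>k. (t - s + (1/2)^k) * norm (G f)) \<longlonglongrightarrow> (t - s + 0) * norm (G f)"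
    by (intro tendsto_intros LIMSEQ_power_zero) simp
  then show "(\<lambda>k. (t - s + (1/2)^k) * norm (G f)) \<longlonglongrightarrow> (t - s) * norm (G f)" by simp
  have "norm (euler_approx k t f - euler_approx k s f) \<le> (t - s + (1/2)^k) * norm (G f)" for k
  proof -
    let ?n = "dyadic_steps k s" and ?m = "dyadic_steps k t"
    have nm: "?n \<le> ?m" using assms by (simp add: dyadic_steps_def nat_mono floor_mono)
    have "norm (euler_approx k t f - euler_approx k s f) \<le> real (?m - ?n) * (1/2)^k * norm (G f)"
      unfolding euler_approx_def by (rule norm_K_pow_diff[OF _ assms(3) nm]) simp
    also have "real (?m - ?n) * (1/2)^k = real ?m * (1/2)^k - real ?n * (1/2)^k"
      using nm by (simp add: of_nat_diff algebra_simps)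
    also have "(real ?m * (1/2)^k - real ?n * (1/2)^k) * norm (G f)
        \<le> (t - s + (1/2)^k) * norm (G f)"
      using dyadic_steps_mult_le[OF t, of k] dyadic_steps_mult_gt[OF assms(1), of k]
      by (intro mult_right_mono) auto
    finally show ?thesis .
  qed
  then show "\<exists>N. \<forall>k\<ge>N. norm (euler_approx k t f - euler_approx k s f)
      \<le> (t - s + (1/2)^k) * norm (G f)" by blast
qed

text \<open>Rounding is additive up to one step, so on D the two sides at level k differ by at most
  2^-k |G f|; density and continuity give the rest.\<close>

lemma euler_limit_add:
  assumes s: "0 \<le> s" and t: "0 \<le> t"
  shows "euler_limit (s + t) f = euler_limit s (euler_limit t f)"
proof (rule continuous_maps_agree_on_dense[where f = "euler_limit (s + t)"
      and g = "\<lambda>f. euler_limit s (euler_limit t f)", OF _ _ dense])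
  have st: "0 \<le> s + t" using s t by simp
  have c: "continuous_on UNIV (euler_limit r)" if "0 \<le> r" for r
    using that by (intro continuous_on_linear_contraction linear_euler_limit norm_euler_limit)
  show "continuous_on UNIV (euler_limit (s + t))" by (rule c[OF st])
  show "continuous_on UNIV (\<lambda>f. euler_limit s (euler_limit t f))"
    by (rule continuous_on_compose2[OF c[OF s] c[OF t]]) simp
next
  fix f assume f: "f \<in> D"
  have st: "0 \<le> s + t" using s t by simp
  have "(\<lambda>k. euler_approx k s (euler_approx k t f - euler_limit t f)) \<longlonglongrightarrow> 0"
  proof (rule Lim_null_comparison)
    show "\<forall>\<^sub>F k in sequentially. norm (euler_approx k s (euler_approx k t f - euler_limit t f))
        \<le> norm (euler_approx k t f - euler_limit t f)" by (simp add: norm_euler_approx)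
    show "(\<lambda>k. norm (euler_approx k t f - euler_limit t f)) \<longlonglongrightarrow> 0"
      using euler_approx_tendsto[OF t] tendsto_norm_zero LIM_zero by blast
  qed
  from tendsto_add[OF this euler_approx_tendsto[OF s, of "euler_limit t f"]]
  have 1: "(\<lambda>k. euler_approx k s (euler_approx k t f)) \<longlonglongrightarrow> euler_limit s (euler_limit t f)"
    by (simp add: linear_diff[OF linear_euler_approx])
  have 2: "(\<lambda>k. euler_approx k (s + t) f - euler_approx k s (euler_approx k t f)) \<longlonglongrightarrow> 0"
  proof (rule Lim_null_comparison)
    show "(\<lambda>k. (1/2)^k * norm (G f)) \<longlonglongrightarrow> 0"
      by (intro tendsto_mult_left_zero LIMSEQ_power_zero) simp
    have "norm (euler_approx k (s + t) f - euler_approx k s (euler_approx k t f))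
        \<le> (1/2)^k * norm (G f)" for k
    proof -
      let ?n = "dyadic_steps k s + dyadic_steps k t" and ?m = "dyadic_steps k (s + t)"
      have nm: "?n \<le> ?m" "?m - ?n \<le> 1" using dyadic_steps_add[OF s t, of k] by auto
      have "euler_approx k s (euler_approx k t f) = (K ((1/2)^k) ^^ ?n) f"
        by (simp add: euler_approx_def funpow_add)
      then have "norm (euler_approx k (s + t) f - euler_approx k s (euler_approx k t f))
          \<le> real (?m - ?n) * (1/2)^k * norm (G f)"
        unfolding euler_approx_def[of k "s + t"]
        using norm_K_pow_diff[OF _ f nm(1), of "(1/2)^k"] by simp
      also have "\<dots> \<le> 1 * (1/2)^k * norm (G f)" using nm(2) by (intro mult_right_mono) auto
      finally show ?thesis by simp
    qed
    then show "\<forall>\<^sub>F k in sequentially. norm (euler_approx k (s + t) f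
        - euler_approx k s (euler_approx k t f)) \<le> (1/2)^k * norm (G f)" by simp
  qed
  from tendsto_add[OF 2 1] show "euler_limit (s + t) f = euler_limit s (euler_limit t f)"
    by (intro LIMSEQ_unique[OF euler_approx_tendsto[OF st]]) simp
qed

lemma continuous_on_euler_limit: "continuous_on {0..} (\<lambda>t. euler_limit t f)"
proof (rule continuous_onI)
  fix t e :: real assume t: "t \<in> {0..}" and e: "e > 0"
  obtain g where g: "g \<in> D" "norm (f - g) < e / 3"
    using dense e closure_approachable[of f D]
    by (metis UNIV_I dist_norm norm_minus_commute zero_less_divide_iff zero_less_numeral)
  define N where "N = norm (G g) + 1"
  have N: "N > 0" "norm (G g) \<le> N" by (auto simp: N_def add_nonneg_pos)
  define d where "d = e / (3 * N)"
  have d: "d > 0" using e N by (simp add: d_def)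
  have "dist (euler_limit s f) (euler_limit t f) \<le> e" if s: "s \<in> {0..}" "dist s t < d" for s
  proof -
    have *: "norm (euler_limit b g - euler_limit a g) \<le> e / 3" if "0 \<le> a" "a \<le> b" "b - a < d" for a b
    proof -
      have "norm (euler_limit b g - euler_limit a g) \<le> (b - a) * norm (G g)"
        using norm_euler_limit_diff that g by blast
      also have "\<dots> \<le> d * N" using that d N by (intro mult_mono) auto
      also have "\<dots> = e / 3" using N by (simp add: d_def)
      finally show ?thesis .
    qed
    have st: "norm (euler_limit s g - euler_limit t g) \<le> e / 3"
      using *[of s t] *[of t s] s t by (cases "s \<le> t") (auto simp: dist_real_def norm_minus_commute)
    have s0: "0 \<le> s" and t0: "0 \<le> t" using s t by auto
    have "euler_limit s f - euler_limit t f
        = euler_limit s (f - g) + (euler_limit s g - euler_limit t g) + euler_limit t (g - f)"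
      by (simp add: linear_diff[OF linear_euler_limit] s0 t0)
    also have "norm \<dots> \<le> norm (euler_limit s (f - g)) + norm (euler_limit s g - euler_limit t g)
        + norm (euler_limit t (g - f))"
      by (intro norm_triangle_le add_mono norm_triangle_ineq order_refl)
    also have "\<dots> \<le> e / 3 + e / 3 + e / 3"
      using norm_euler_limit[OF s0, of "f - g"] norm_euler_limit[OF t0, of "g - f"] g(2) st
      by (intro add_mono) (auto simp: norm_minus_commute)
    finally show ?thesis by (simp add: dist_norm)
  qed
  then show "\<exists>d>0. \<forall>s\<in>{0..}. dist s t < d \<longrightarrow> dist (euler_limit s f) (euler_limit t f) \<le> e"
    using d by blast
qed

text \<open>Each step adds h K^(n+1) (G f), which has to be compared with h G f. Since G f may lie
  outside D, the comparison passes through a nearby g in D, whence the term 2 |G f - g|.\<close>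

lemma norm_K_pow_first_order:
  assumes h: "h > 0" and f: "f \<in> D" and g: "g \<in> D"
  shows "norm ((K h ^^ n) f - f - (real n * h) *\<^sub>R G f)
    \<le> real n * h * (2 * norm (G f - g) + real n * h * norm (G g))"
proof (induction n)
  case (Suc n)
  let ?P = "K h ^^ Suc n"
  have lin: "linear ?P" by (rule linear_K_pow[OF h])
  have "?P (G f) - G f = ?P (G f - g) + (?P g - g) + (g - G f)"
    by (simp only: linear_diff[OF lin]) simp
  then have "norm (?P (G f) - G f) \<le> norm (?P (G f - g)) + norm (?P g - g) + norm (g - G f)"
    by (metis (no_types, lifting) norm_triangle_le add_mono norm_triangle_ineq order_refl)
  also have "\<dots> \<le> norm (G f - g) + real (Suc n) * h * norm (G g) + norm (G f - g)"
    using norm_K_pow[OF h, of "Suc n" "G f - g"] norm_K_pow_minus_id[OF h g, of "Suc n"]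
    by (intro add_mono) (auto simp: norm_minus_commute)
  finally have 1: "norm (?P (G f) - G f) \<le> 2 * norm (G f - g) + real (Suc n) * h * norm (G g)"
    by simp
  have "?P f - (K h ^^ n) f = h *\<^sub>R ?P (G f)"
    using K_minus_id[OF h K_pow_D[OF h f], of n] by (simp add: G_K_pow h f)
  then have "?P f - f - (real (Suc n) * h) *\<^sub>R G f
      = ((K h ^^ n) f - f - (real n * h) *\<^sub>R G f) + h *\<^sub>R (?P (G f) - G f)"
    by (simp add: algebra_simps)
  then have "norm (?P f - f - (real (Suc n) * h) *\<^sub>R G f)
      \<le> norm ((K h ^^ n) f - f - (real n * h) *\<^sub>R G f) + h * norm (?P (G f) - G f)"
    using norm_triangle_ineq h by (metis abs_of_pos norm_scaleR)
  also have "\<dots> \<le> real n * h * (2 * norm (G f - g) + real n * h * norm (G g))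
      + h * (2 * norm (G f - g) + real (Suc n) * h * norm (G g))"
    using Suc.IH 1 h by (intro add_mono mult_left_mono) auto
  \<comment> \<open>The coefficients of h^2 |G g| are n^2 + n + 1 on the left and (n + 1)^2 on the
    right; the slack is n.\<close>
  also have "\<dots> \<le> real (Suc n) * h * (2 * norm (G f - g) + real (Suc n) * h * norm (G g))"
  proof -
    have "0 \<le> real n * (h * (h * norm (G g)))" using h by simp
    then show ?thesis by (simp add: algebra_simps)
  qed
  finally show ?case .
qed simp

lemma norm_euler_limit_first_order:
  assumes t: "0 \<le> t" and f: "f \<in> D" and g: "g \<in> D"
  shows "norm (euler_limit t f - f - t *\<^sub>R G f) \<le> t * (2 * norm (G f - g) + t * norm (G g))"
proof (rule LIMSEQ_le)
  let ?r = "\<lambda>k. real (dyadic_steps k t) * (1/2)^k"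
  have r: "?r \<longlonglongrightarrow> t"
  proof (rule tendsto_sandwich)
    have "(\<lambda>k. t - (1/2)^k) \<longlonglongrightarrow> t - 0" by (intro tendsto_intros LIMSEQ_power_zero) simp
    then show "(\<lambda>k. t - (1/2)^k) \<longlonglongrightarrow> t" by simp
    show "\<forall>\<^sub>F k in sequentially. t - (1/2)^k \<le> ?r k"
      using dyadic_steps_mult_gt[OF t] by (intro always_eventually) (auto intro: less_imp_le)
    show "\<forall>\<^sub>F k in sequentially. ?r k \<le> t"
      using dyadic_steps_mult_le[OF t] by (intro always_eventually) auto
  qed simp
  show "(\<lambda>k. norm (euler_approx k t f - f - ?r k *\<^sub>R G f)) \<longlonglongrightarrow> norm (euler_limit t f - f - t *\<^sub>R G f)"
    by (intro tendsto_intros euler_approx_tendsto t r)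
  show "(\<lambda>k. ?r k * (2 * norm (G f - g) + ?r k * norm (G g)))
      \<longlonglongrightarrow> t * (2 * norm (G f - g) + t * norm (G g))"
    by (intro tendsto_intros r)
  show "\<exists>N. \<forall>k\<ge>N. norm (euler_approx k t f - f - ?r k *\<^sub>R G f)
      \<le> ?r k * (2 * norm (G f - g) + ?r k * norm (G g))"
    using norm_K_pow_first_order[OF _ f g] by (simp add: euler_approx_def)
qed

lemma euler_limit_derivative:
  assumes f: "f \<in> D"
  shows "((\<lambda>t. (euler_limit t f - f) /\<^sub>R t) \<longlongrightarrow> G f) (at_right 0)"
proof (rule tendstoI)
  fix e :: real assume e: "e > 0"
  \<comment> \<open>The bound contains 2 |G f - g|, so e/4 uses up half of e; the other half is d *
    N.\<close>
  obtain g where g: "g \<in> D" "norm (G f - g) < e / 4"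
    using dense e closure_approachable[of "G f" D]
    by (metis UNIV_I dist_norm norm_minus_commute zero_less_divide_iff zero_less_numeral)
  define N where "N = norm (G g) + 1"
  have N: "N > 0" "norm (G g) \<le> N" by (auto simp: N_def add_nonneg_pos)
  define d where "d = e / (2 * N)"
  have d: "d > 0" using e N by (simp add: d_def)
  have "dist ((euler_limit t f - f) /\<^sub>R t) (G f) < e" if t: "0 < t" "t < d" for t
  proof -
    have "(euler_limit t f - f) /\<^sub>R t - G f = (euler_limit t f - f - t *\<^sub>R G f) /\<^sub>R t"
      using t by (simp add: algebra_simps)
    then have "norm ((euler_limit t f - f) /\<^sub>R t - G f) = norm (euler_limit t f - f - t *\<^sub>R G f) / t"
      using t by (simp add: divide_inverse mult.commute)
    also have "\<dots> \<le> t * (2 * norm (G f - g) + t * norm (G g)) / t"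
      using norm_euler_limit_first_order[OF _ f g(1), of t] t by (intro divide_right_mono) auto
    also have "\<dots> = 2 * norm (G f - g) + t * norm (G g)" using t by simp
    also have "\<dots> \<le> 2 * norm (G f - g) + d * N"
      using t d N by (intro add_mono mult_mono) auto
    also have "\<dots> < e" using g(2) N by (simp add: d_def)
    finally show ?thesis by (simp add: dist_norm)
  qed
  then show "\<forall>\<^sub>F t in at_right 0. dist ((euler_limit t f - f) /\<^sub>R t) (G f) < e"
    using d unfolding eventually_at_right_field by blast
qed

end

section \<open>Maximal dissipative operators as generators\<close>

lemma generator_eq_Some_iff:
  "generator S f = Some l \<longleftrightarrow> ((\<lambda>t. (S t f - f) /\<^sub>R t) \<longlongrightarrow> l) (at_right 0)"
proof -
  have "Lim (at_right 0) (\<lambda>t. (S t f - f) /\<^sub>R t) = l"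
    if "((\<lambda>t. (S t f - f) /\<^sub>R t) \<longlongrightarrow> l) (at_right 0)" for l
    using that by (intro tendsto_Lim) simp_all
  then show ?thesis by (auto simp: generator_def)
qed

text \<open>Pair f - h g with f and use Cauchy-Schwarz. With g = G f this gives injectivity of 1 - h
  G, contractivity of its inverse and, for closed G, closedness of its range.\<close>

lemma norm_le_norm_diff_dissipative:
  fixes f g :: "'a::real_inner"
  assumes h: "h > 0" and fg: "inner f g \<le> 0"
  shows "norm f \<le> norm (f - h *\<^sub>R g)"
proof (cases "f = 0")
  case False
  have "h * inner f g \<le> 0" using fg h by (simp add: mult_nonneg_nonpos)
  then have "norm f * norm f \<le> inner f (f - h *\<^sub>R g)"
    by (simp add: inner_diff_right power2_norm_eq_inner flip: power2_eq_square)
  also have "\<dots> \<le> norm f * norm (f - h *\<^sub>R g)" by (rule norm_cauchy_schwarz)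
  finally show ?thesis using False by simp
qed simp

locale m_dissipative =
  fixes G :: "'a::chilbert_space \<rightharpoonup> 'a"
  assumes lin: "linear_op G" and dense: "densely_defined G"
    and dissipative: "\<And>f. f \<in> dom G \<Longrightarrow> inner f (G \<cdot> f) \<le> 0"
    and surj: "\<And>h g. h > 0 \<Longrightarrow> \<exists>f\<in>dom G. f - h *\<^sub>R (G \<cdot> f) = g"
begin

definition K :: "real \<Rightarrow> 'a \<Rightarrow> 'a" where
  "K h g = (THE f. f \<in> dom G \<and> f - h *\<^sub>R (G \<cdot> f) = g)"

lemma K_unique: "h > 0 \<Longrightarrow> f \<in> dom G \<Longrightarrow> K h (f - h *\<^sub>R (G \<cdot> f)) = f"
  unfolding K_def
proof (rule the_equality)
  fix f' assume *: "h > 0" "f \<in> dom G" "f' \<in> dom G \<and> f' - h *\<^sub>R (G \<cdot> f') = f - h *\<^sub>R (G \<cdot> f)"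
  have d: "f' - f \<in> dom G" "G \<cdot> (f' - f) = G \<cdot> f' - G \<cdot> f" using * linear_op_diff[OF lin] by blast+
  have "norm (f' - f) \<le> norm ((f' - h *\<^sub>R (G \<cdot> f')) - (f - h *\<^sub>R (G \<cdot> f)))"
    using norm_le_norm_diff_dissipative[OF *(1) dissipative[OF d(1)]] unfolding d(2) by (simp add: algebra_simps)
  then show "f' = f" using * by simp
qed simp

lemma K:
  assumes h: "h > 0" shows "K h g \<in> dom G" "K h g - h *\<^sub>R (G \<cdot> K h g) = g"
proof -
  obtain f where f: "f \<in> dom G" "f - h *\<^sub>R (G \<cdot> f) = g" using surj[OF h] by blast
  then have "K h g = f" using K_unique[OF h f(1)] by simp
  then show "K h g \<in> dom G" "K h g - h *\<^sub>R (G \<cdot> K h g) = g" using f by simp_all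
qed

lemma K_scaleC:
  assumes h: "h > 0" shows "K h (c *\<^sub>C g) = c *\<^sub>C K h g"
proof -
  have d: "c *\<^sub>C K h g \<in> dom G" "G \<cdot> (c *\<^sub>C K h g) = c *\<^sub>C (G \<cdot> K h g)"
    using linear_op_scaleC[OF lin K(1)[OF h]] by blast+
  have "c *\<^sub>C K h g - h *\<^sub>R (c *\<^sub>C (G \<cdot> K h g)) = c *\<^sub>C g"
    unfolding linear_scale[OF bounded_linear.linear[OF bounded_linear_scaleC], symmetric] scaleC_diff_right[symmetric]
      K(2)[OF h] ..
  then show ?thesis using K_unique[OF h d(1)] unfolding d(2) by simp
qed

lemma K_add:
  assumes h: "h > 0" shows "K h (f + g) = K h f + K h g"
proof -
  have d: "K h f + K h g \<in> dom G" "G \<cdot> (K h f + K h g) = G \<cdot> K h f + G \<cdot> K h g"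
    using linear_op_add[OF lin K(1)[OF h] K(1)[OF h]] by blast+
  have "K h f + K h g - h *\<^sub>R (G \<cdot> K h f + G \<cdot> K h g)
      = (K h f - h *\<^sub>R (G \<cdot> K h f)) + (K h g - h *\<^sub>R (G \<cdot> K h g))"
    by (simp add: algebra_simps)
  then have "K h f + K h g - h *\<^sub>R (G \<cdot> K h f + G \<cdot> K h g) = f + g" unfolding K(2)[OF h] .
  then show ?thesis using K_unique[OF h d(1)] unfolding d(2) by simp
qed

lemma clinear_map_K: "h > 0 \<Longrightarrow> clinear_map (K h)"
  by (simp add: clinear_map_def K_add K_scaleC)

lemma norm_K: "h > 0 \<Longrightarrow> norm (K h g) \<le> norm g"
  using norm_le_norm_diff_dissipative[of h "K h g" "G \<cdot> K h g"] dissipative[OF K(1)] K(2) by simp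

sublocale contractive_resolvents "dom G" "\<lambda>f. G \<cdot> f" K
proof
  show "subspace (dom G)" by (rule subspace_dom[OF lin])
  show "closure (dom G) = UNIV" using dense by (simp add: densely_defined_def)
qed (simp_all add: linear_op_add[OF lin] linear_op_scaleR[OF lin]
    K_add linear_scale[OF clinear_map_linear[OF clinear_map_K]] norm_K K K_unique del: domIff)

text \<open>For the inclusion of the generator in G, the equation g - G g = f - l is solved in
  \<open>dom G\<close>; then d = f - g has derivative d at 0. A contraction satisfies (d, S_t d - d)
  \<le> 0, so |d|^2 \<le> 0 and f = g.\<close>

lemma generator_euler_limit: "generator euler_limit = G"
proof (rule map_eq_if_same_graph)
  fix f l
  show "generator euler_limit f = Some l \<longleftrightarrow> G f = Some l"
    unfolding generator_eq_Some_iff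
  proof
    assume "G f = Some l"
    then have "f \<in> dom G" "G \<cdot> f = l" by auto
    then show "((\<lambda>t. (euler_limit t f - f) /\<^sub>R t) \<longlongrightarrow> l) (at_right 0)"
      using euler_limit_derivative by blast
  next
    assume l: "((\<lambda>t. (euler_limit t f - f) /\<^sub>R t) \<longlongrightarrow> l) (at_right 0)"
    define g where "g = K 1 (f - l)"
    have g: "g \<in> dom G" "g - G \<cdot> g = f - l" using K[of 1 "f - l"] by (simp_all add: g_def)
    define d where "d = f - g"
    have pos: "\<forall>\<^sub>F t in at_right (0::real). 0 < t" by (simp add: eventually_at_right_less)
    have "((\<lambda>t. (euler_limit t f - f) /\<^sub>R t - (euler_limit t g - g) /\<^sub>R t) \<longlongrightarrow> l - G \<cdot> g) (at_right 0)"
      by (intro tendsto_diff l euler_limit_derivative g)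
    moreover have "\<forall>\<^sub>F t in at_right 0. (euler_limit t f - f) /\<^sub>R t - (euler_limit t g - g) /\<^sub>R t
        = (euler_limit t d - d) /\<^sub>R t"
      using pos by eventually_elim (simp add: d_def linear_diff[OF linear_euler_limit] algebra_simps)
    moreover have "l - G \<cdot> g = d" using g(2) by (simp add: d_def algebra_simps)
    ultimately have "((\<lambda>t. (euler_limit t d - d) /\<^sub>R t) \<longlongrightarrow> d) (at_right 0)"
      by (simp add: tendsto_cong)
    then have "((\<lambda>t. inner d ((euler_limit t d - d) /\<^sub>R t)) \<longlongrightarrow> inner d d) (at_right 0)"
      by (intro tendsto_intros)
    moreover have "\<forall>\<^sub>F t in at_right 0. inner d ((euler_limit t d - d) /\<^sub>R t) \<le> 0"
      using pos
    proof eventually_elim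
      case (elim t)
      have "inner d (euler_limit t d) \<le> norm d * norm (euler_limit t d)" by (rule norm_cauchy_schwarz)
      also have "\<dots> \<le> norm d * norm d" using norm_euler_limit[of t d] elim by (intro mult_left_mono) auto
      finally have "inner d (euler_limit t d - d) \<le> 0"
        by (simp add: inner_diff_right power2_norm_eq_inner flip: power2_eq_square)
      then show ?case using elim by (simp add: mult_nonneg_nonpos)
    qed
    ultimately have "inner d d \<le> 0" by (rule tendsto_upperbound) simp
    then have "d = 0" by (metis inner_ge_zero inner_eq_zero_iff order_antisym)
    then have "f = g" by (simp add: d_def)
    then show "G f = Some l" using g by auto
  qed
qed

lemma generates: "generates_contraction_semigroup G"
proof -
  have "contraction_semigroup euler_limit"
    unfolding contraction_semigroup_def clinear_map_def
    by (simp add: linear_add[OF linear_euler_limit] norm_euler_limit euler_limit_0 euler_limit_add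
        continuous_on_euler_limit euler_limit_commute[OF _ bounded_linear_scaleC] K_scaleC)
  then show ?thesis
    unfolding generates_contraction_semigroup_def using generator_euler_limit by blast
qed

end

section \<open>The damped wave operator\<close>

lemma mem_ran_iff: "y \<in> ran T \<longleftrightarrow> (\<exists>f\<in>dom T. T \<cdot> f = y)"
  by (force simp: ran_def dom_def)

lemma unitary_onto_props:
  assumes "unitary_onto W K"
  shows "linear W" "W (c *\<^sub>C x) = c *\<^sub>C W x" "inner (W x) (W y) = inner x y" "norm (W x) = norm x"
    "range W = K"
proof -
  show "linear W" "W (c *\<^sub>C x) = c *\<^sub>C W x" "range W = K"
    using assms by (simp_all add: unitary_onto_def clinear_map_linear clinear_map_def)
  show i: "inner (W x) (W y) = inner x y" for x y
    using assms by (simp add: unitary_onto_def flip: Re_cinner)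
  show "norm (W x) = norm x" by (simp add: norm_eq_sqrt_inner i)
qed

text \<open>The extension is the closure of the relation \<open>{(J f, B f) | f}\<close>, which is linear and isometric.\<close>

lemma unitary_extension:
  fixes J :: "'a::chilbert_space \<rightharpoonup> 'h::chilbert_space" and B :: "'a \<rightharpoonup> 'c::chilbert_space"
  assumes J: "linear_op J" "closure (ran J) = UNIV" and B: "linear_op B" "dom B = dom J"
    and iso: "\<And>f. f \<in> dom B \<Longrightarrow> norm (J \<cdot> f) = norm (B \<cdot> f)"
  shows "unitary_onto (unitary_extension J (closure (ran B)) B) (closure (ran B))"
    and "\<And>f. f \<in> dom B \<Longrightarrow> unitary_extension J (closure (ran B)) B (J \<cdot> f) = B \<cdot> f"
proof -
  define P where "P x y \<longleftrightarrow> (\<exists>u. (\<forall>n. u n \<in> dom B) \<and> (\<lambda>n. J \<cdot> u n) \<longlonglongrightarrow> x \<and> (\<lambda>n. B \<cdot> u n) \<longlonglongrightarrow> y)"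
    for x y
  have PI: "P x y" if "\<And>n. u n \<in> dom B" "(\<lambda>n. J \<cdot> u n) \<longlonglongrightarrow> x" "(\<lambda>n. B \<cdot> u n) \<longlonglongrightarrow> y" for u x y
    unfolding P_def using that by (intro exI[of _ u]) simp
  have Jd: "J \<cdot> (f + g) = J \<cdot> f + J \<cdot> g" "J \<cdot> (f - g) = J \<cdot> f - J \<cdot> g"
    if "f \<in> dom B" "g \<in> dom B" for f g
    using that linear_op_add[OF J(1)] linear_op_diff[OF J(1)] unfolding B(2) by blast+
  have Bd: "f + g \<in> dom B" "B \<cdot> (f + g) = B \<cdot> f + B \<cdot> g" "f - g \<in> dom B" "B \<cdot> (f - g) = B \<cdot> f - B \<cdot> g"
    if "f \<in> dom B" "g \<in> dom B" for f g
    using that linear_op_add[OF B(1)] linear_op_diff[OF B(1)] by blast+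
  have scale: "J \<cdot> (c *\<^sub>C f) = c *\<^sub>C (J \<cdot> f)" "c *\<^sub>C f \<in> dom B" "B \<cdot> (c *\<^sub>C f) = c *\<^sub>C (B \<cdot> f)"
    if "f \<in> dom B" for f c
    using that linear_op_scaleC[OF J(1)] linear_op_scaleC[OF B(1)] unfolding B(2) by blast+
  have P_add: "P (x + x') (y + y')" if "P x y" "P x' y'" for x y x' y'
  proof -
    obtain u where "\<forall>n. u n \<in> dom B" "(\<lambda>n. J \<cdot> u n) \<longlonglongrightarrow> x" "(\<lambda>n. B \<cdot> u n) \<longlonglongrightarrow> y"
      using \<open>P x y\<close> unfolding P_def by blast
    moreover obtain u' where "\<forall>n. u' n \<in> dom B" "(\<lambda>n. J \<cdot> u' n) \<longlonglongrightarrow> x'" "(\<lambda>n. B \<cdot> u' n) \<longlonglongrightarrow> y'"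
      using \<open>P x' y'\<close> unfolding P_def by blast
    ultimately show ?thesis
      by (intro PI[of "\<lambda>n. u n + u' n"]) (simp_all add: Jd Bd tendsto_add del: domIff)
  qed
  have P_scale: "P (c *\<^sub>C x) (c *\<^sub>C y)" if P: "P x y" for x y c
  proof -
    obtain u where "\<forall>n. u n \<in> dom B" "(\<lambda>n. J \<cdot> u n) \<longlonglongrightarrow> x" "(\<lambda>n. B \<cdot> u n) \<longlonglongrightarrow> y"
      using P unfolding P_def by (elim exE conjE) (rule that)
    then show ?thesis
      by (intro PI[of "\<lambda>n. c *\<^sub>C u n"])
        (simp_all add: scale bounded_linear.tendsto[OF bounded_linear_scaleC] del: domIff)
  qed
  have P_norm: "norm x = norm y" if P: "P x y" for x y
  proof -
    obtain u where u: "\<forall>n. u n \<in> dom B" "(\<lambda>n. J \<cdot> u n) \<longlonglongrightarrow> x" "(\<lambda>n. B \<cdot> u n) \<longlonglongrightarrow> y"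
      using P unfolding P_def by (elim exE conjE) (rule that)
    have "(\<lambda>n. norm (J \<cdot> u n)) \<longlonglongrightarrow> norm x" "(\<lambda>n. norm (B \<cdot> u n)) \<longlonglongrightarrow> norm y"
      by (intro tendsto_intros u)+
    moreover have "norm (J \<cdot> u n) = norm (B \<cdot> u n)" for n using iso u(1) by blast
    ultimately show ?thesis by (auto intro: LIMSEQ_unique)
  qed
  \<comment> \<open>Isometry passes to limits, so two values of the same x differ by a vector of
    norm 0.\<close>
  have P_unique: "y = y'" if "P x y" "P x y'" for x y y'
  proof -
    have "P (x + (- 1) *\<^sub>C x) (y + (- 1) *\<^sub>C y')" using that P_add P_scale by blast
    then have "norm (x - x) = norm (y - y')" using P_norm by (fastforce simp: scaleC_minus_left)
    then show ?thesis by simp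
  qed
  have P_base: "P (J \<cdot> f) (B \<cdot> f)" if "f \<in> dom B" for f
    using that by (intro PI[of "\<lambda>_. f"]) simp_all
  have dist: "dist (J \<cdot> f) (J \<cdot> g) = dist (B \<cdot> f) (B \<cdot> g)" if "f \<in> dom B" "g \<in> dom B" for f g
    using iso[of "f - g"] that by (simp add: dist_norm Jd Bd del: domIff)
  have P_ex: "\<exists>y. P x y" for x
  proof -
    obtain w where w: "\<And>n. w n \<in> ran J" "w \<longlonglongrightarrow> x" using J(2) closure_sequential[of x "ran J"] by auto
    have "\<forall>n. \<exists>f. f \<in> dom B \<and> J \<cdot> f = w n" using w(1) unfolding mem_ran_iff B(2) by blast
    then obtain u where u: "\<And>n. u n \<in> dom B" "\<And>n. J \<cdot> u n = w n" by metis
    have "Cauchy (\<lambda>n. J \<cdot> u n)" unfolding u(2) using w(2) by (rule LIMSEQ_imp_Cauchy)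
    then have "Cauchy (\<lambda>n. B \<cdot> u n)" unfolding Cauchy_def dist[OF u(1) u(1)] .
    then obtain y where "(\<lambda>n. B \<cdot> u n) \<longlonglongrightarrow> y" using Cauchy_convergent convergent_def by blast
    then have "P x y" using u w(2) by (intro PI[of u]) simp_all
    then show ?thesis ..
  qed
  \<comment> \<open>The isometry works in both directions: approximants in \<open>ran B\<close> pull
    back to a Cauchy sequence in the completion. Hence the image is the whole closure, not just a
    dense part of it.\<close>
  have P_surj: "\<exists>x. P x y" if y: "y \<in> closure (ran B)" for y
  proof -
    obtain w where w: "\<And>n. w n \<in> ran B" "w \<longlonglongrightarrow> y" using y unfolding closure_sequential by blast
    have "\<forall>n. \<exists>f. f \<in> dom B \<and> B \<cdot> f = w n" using w(1) unfolding mem_ran_iff by blast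
    then obtain u where u: "\<And>n. u n \<in> dom B" "\<And>n. B \<cdot> u n = w n" by metis
    have "Cauchy (\<lambda>n. B \<cdot> u n)" unfolding u(2) using w(2) by (rule LIMSEQ_imp_Cauchy)
    then have "Cauchy (\<lambda>n. J \<cdot> u n)" unfolding Cauchy_def dist[OF u(1) u(1)] .
    then obtain x where "(\<lambda>n. J \<cdot> u n) \<longlonglongrightarrow> x" using Cauchy_convergent convergent_def by blast
    then have "P x y" using u w(2) by (intro PI[of u]) simp_all
    then show ?thesis ..
  qed
  have P_ran: "y \<in> closure (ran B)" if P: "P x y" for x y
  proof -
    obtain u where u: "\<forall>n. u n \<in> dom B" "(\<lambda>n. B \<cdot> u n) \<longlonglongrightarrow> y"
      using P unfolding P_def by (elim exE conjE) (rule that)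
    have "B \<cdot> u n \<in> ran B" for n using u(1) unfolding mem_ran_iff by blast
    then show ?thesis unfolding closure_sequential using u(2) by (intro exI[of _ "\<lambda>n. B \<cdot> u n"]) simp
  qed
  define W where "W x = (THE y. P x y)" for x
  have W_eq: "W x = y" if "P x y" for x y
    unfolding W_def using that P_unique by (intro the_equality)
  have PW: "P x (W x)" for x using P_ex[of x] W_eq by blast
  have "clinear_map W" unfolding clinear_map_def
    by (auto intro!: W_eq P_add P_scale PW)
  then have W1: "unitary_onto W (closure (ran B))"
    unfolding unitary_onto_def
    using clinear_map_isometry P_norm[OF PW, symmetric] P_ran[OF PW] P_surj W_eq by blast
  have W2: "W (J \<cdot> f) = B \<cdot> f" if "f \<in> dom B" for f using W_eq P_base that by blast
  have uniq: "W' = W" if W': "unitary_onto W' (closure (ran B))" "\<forall>f\<in>dom B. W' (J \<cdot> f) = B \<cdot> f" for W'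
  proof
    fix x show "W' x = W x"
    proof (rule continuous_maps_agree_on_dense[OF _ _ J(2)])
      show "continuous_on UNIV W" "continuous_on UNIV W'"
        using unitary_onto_props[OF W1] unitary_onto_props[OF W'(1)]
        by (simp_all add: continuous_on_linear_contraction)
      fix x assume "x \<in> ran J"
      then obtain f where "f \<in> dom B" "x = J \<cdot> f" unfolding mem_ran_iff B(2) by blast
      then show "W' x = W x" using W'(2) W2 by simp
    qed
  qed
  have "unitary_extension J (closure (ran B)) B = W"
    unfolding unitary_extension_def using W1 W2 uniq by (intro the_equality) blast+
  then show "unitary_onto (unitary_extension J (closure (ran B)) B) (closure (ran B))"
    and "\<And>f. f \<in> dom B \<Longrightarrow> unitary_extension J (closure (ran B)) B (J \<cdot> f) = B \<cdot> f"
    using W1 W2 by simp_all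
qed

section \<open>The operator G: unitary equivalence with Q, density and closedness\<close>

locale damped_wave = closed_dense_op A
  for A :: "'a::chilbert_space \<rightharpoonup> 'b::chilbert_space" +
  fixes R :: "'a \<rightharpoonup> 'a" and J :: "'a \<rightharpoonup> 'h::chilbert_space"
  assumes ker_A: "ker_op A = {0}"
    and lin_R: "linear_op R" and dense_R: "densely_defined R"
    and dom_A_R: "dom A \<subseteq> dom R \<inter> dom (adj R)"
    and completion: "is_completion A J"
begin

abbreviation S :: "'a \<rightharpoonup> 'a" where "S \<equiv> abs_op A"
abbreviation V :: "'h \<Rightarrow> 'b" where "V \<equiv> tilde_op J A"
abbreviation W :: "'h \<Rightarrow> 'a" where "W \<equiv> tilde_abs J A"

sublocale S: nonneg_selfadjoint "abs_op A"
  by unfold_locales (rule abs_op)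

lemma dom_S [simp]: "dom S = dom A" by (rule dom_abs_op)

lemma S_SomeD: "S f = Some h \<Longrightarrow> f \<in> dom A \<and> S \<cdot> f = h"
  using domI[of S f h] by (simp del: domIff)

lemma lin_J: "linear_op J" and dom_J [simp]: "dom J = dom A" and ran_J: "closure (ran J) = UNIV"
  and norm_J: "f \<in> dom A \<Longrightarrow> norm (J \<cdot> f) = norm (A \<cdot> f)"
  using completion by (auto simp: is_completion_def norm_eq_sqrt_inner simp flip: Re_cinner)

text \<open>The orthogonal complement of \<open>ran |A|\<close> is the kernel of its adjoint, that
  is of \<open>|A|\<close>, which equals the kernel of A. So the extension of \<open>|A|\<close> is
  onto all of H_1, as \<open>tilde_abs\<close> demands.\<close>

lemma closure_ran_S: "closure (ran S) = UNIV"
proof (rule closure_eq_UNIV_if_no_orthogonal)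
  show "subspace (ran S)"
  proof (rule subspaceI)
    show "0 \<in> ran S" unfolding mem_ran_iff using linear_op_0[OF S.lin] by blast
    show "x + y \<in> ran S" if "x \<in> ran S" "y \<in> ran S" for x y
      using that linear_op_add[OF S.lin] unfolding mem_ran_iff by metis
    show "c *\<^sub>R x \<in> ran S" if "x \<in> ran S" for x c
      using that linear_op_scaleR[OF S.lin] unfolding mem_ran_iff by metis
  qed
  fix y assume y: "\<And>v. v \<in> ran S \<Longrightarrow> inner y v = 0"
  have "adj S y = Some 0"
    unfolding adj_eq_Some_iff[OF S.lin S.dense] using y mem_ran_iff[of _ S] by auto
  then have "y \<in> dom A" "S \<cdot> y = 0" using S_SomeD[of y 0] by simp_all
  then have "y \<in> ker_op A" using norm_abs_op[of y] by (simp add: ker_op_def del: domIff)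
  then show "y = 0" using ker_A by simp
qed

lemma unitary_V: "unitary_onto V (closure (ran A))" and V_J: "f \<in> dom A \<Longrightarrow> V (J \<cdot> f) = A \<cdot> f"
  unfolding tilde_op_def using unitary_extension[OF lin_J ran_J lin] norm_J by simp_all

text \<open>Density of \<open>ran S\<close> turns its closure into \<open>UNIV\<close>, so
  \<open>tilde_abs J A\<close> and \<open>tilde_op J S\<close> are the same description.\<close>

lemma unitary_W: "unitary_onto W UNIV" and W_J: "f \<in> dom A \<Longrightarrow> W (J \<cdot> f) = S \<cdot> f"
  and tilde_op_S: "tilde_op J S = W"
  unfolding tilde_abs_def tilde_op_def
  using unitary_extension[OF lin_J ran_J S.lin] norm_J norm_abs_op
  by (simp_all add: closure_ran_S)

lemmas W = unitary_onto_props[OF unitary_W]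

lemma W_inj [simp]: "W x = W y \<longleftrightarrow> x = y"
  using W(4)[of "x - y"] linear_diff[OF W(1), of x y] by auto

lemma W_0 [simp]: "W 0 = 0" by (rule linear_0[OF W(1)])

lemma W_surj: obtains x where "W x = y"
  using W(5) by (metis UNIV_I imageE)

text \<open>Both sides are determined by \<open>(V f, A g) = (f, J g) = (W f, S g)\<close> for \<open>g \<in> dom A\<close>.\<close>

lemma adj_V: "adj A (V f) = S (W f)"
proof (rule map_eq_if_same_graph[of "\<lambda>f. adj A (V f)" "\<lambda>f. S (W f)", THEN fun_cong])
  fix f h
  have "inner (V f) (A \<cdot> g) = inner (W f) (S \<cdot> g)" if "g \<in> dom A" for g
    using unitary_onto_props(3)[OF unitary_V, of f "J \<cdot> g"] W(3)[of f "J \<cdot> g"] that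
    by (simp add: V_J W_J del: domIff)
  then have "adj A (V f) = Some h \<longleftrightarrow> adj S (W f) = Some h"
    unfolding adj_eq_Some_iff[OF lin dense] adj_eq_Some_iff[OF S.lin S.dense] by simp
  then show "adj A (V f) = Some h \<longleftrightarrow> S (W f) = Some h" by simp
qed

abbreviation G :: "'h \<times> 'a \<rightharpoonup> 'h \<times> 'a" where "G \<equiv> G_op J A R"

text \<open>By \<open>adj_V\<close> the operator is rewritten with the self-adjoint S, so that G for
  A and G for \<open>|A|\<close> become visibly equal and symmetry of S is available.\<close>

lemma G_eq: "G (x, p) = (if W x \<in> dom A \<and> p \<in> dom A
    then Some (J \<cdot> p, - (S \<cdot> W x) - R \<cdot> p) else None)"
proof -
  have "V x \<in> dom (adj A) \<longleftrightarrow> W x \<in> dom A" unfolding dom_S[symmetric] domIff adj_V ..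
  then show ?thesis unfolding G_op_def by (simp add: adj_V del: domIff)
qed

lemma dom_G: "(x, p) \<in> dom G \<longleftrightarrow> W x \<in> dom A \<and> p \<in> dom A"
  unfolding domIff[of "(x, p)"] G_eq by simp

lemma app_G: "W x \<in> dom A \<Longrightarrow> p \<in> dom A \<Longrightarrow> G \<cdot> (x, p) = (J \<cdot> p, - (S \<cdot> W x) - R \<cdot> p)"
  by (simp add: G_eq del: domIff)

lemma G_abs_op: "G_op J S R = G"
proof
  fix z show "G_op J S R z = G z"
    by (cases z) (simp add: G_op_def[of J S] G_eq tilde_op_S del: domIff)
qed

lemma Q_eq: "Q_op A R = (Some \<circ> U_op J A) \<circ>\<^sub>m scale_op \<i> G \<circ>\<^sub>m (Some \<circ> inv (U_op J A))"
proof
  fix z show "Q_op A R z = ((Some \<circ> U_op J A) \<circ>\<^sub>m scale_op \<i> G \<circ>\<^sub>m (Some \<circ> inv (U_op J A))) z"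
  proof (cases z)
    case (Pair p q)
    \<comment> \<open>This x makes U (x, p) = (p, q), because (-i) i q = q.\<close>
    obtain x where x: "W x = \<i> *\<^sub>C q" by (rule W_surj)
    have inj: "inj (U_op J A)"
    proof (rule injI)
      fix u v assume eq: "U_op J A u = U_op J A v"
      then have "\<i> *\<^sub>C ((- \<i>) *\<^sub>C W (fst u)) = \<i> *\<^sub>C ((- \<i>) *\<^sub>C W (fst v))"
        by (simp add: U_op_def split: prod.splits)
      then have "W (fst u) = W (fst v)" by (simp only: scaleC_scaleC) simp
      then show "u = v" using eq by (simp add: U_op_def split: prod.splits)
    qed
    have "U_op J A (x, p) = (p, q)" by (simp add: U_op_def x scaleC_scaleC)
    then have inv: "inv (U_op J A) (p, q) = (x, p)" by (rule inv_f_eq[OF inj])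
    \<comment> \<open>The domain is a complex subspace, so the factor i in the choice of x leaves
      the domain condition unchanged.\<close>
    have q: "\<i> *\<^sub>C q \<in> dom A \<longleftrightarrow> q \<in> dom A"
    proof
      assume "\<i> *\<^sub>C q \<in> dom A"
      then have "(- \<i>) *\<^sub>C (\<i> *\<^sub>C q) \<in> dom A" using linear_op_scaleC[OF lin] by blast
      then show "q \<in> dom A" by (simp add: scaleC_scaleC)
    qed (use linear_op_scaleC[OF lin] in blast)
    have dom: "(x, p) \<in> dom G \<longleftrightarrow> p \<in> dom A \<and> q \<in> dom A" using q by (auto simp: dom_G x simp del: domIff)
    show ?thesis
    proof (cases "p \<in> dom A \<and> q \<in> dom A")
      case True
      have "G \<cdot> (x, p) = (J \<cdot> p, - (\<i> *\<^sub>C (S \<cdot> q)) - R \<cdot> p)"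
        using app_G[of x p] True q linear_op_scaleC[OF S.lin, of q \<i>] by (simp add: x del: domIff)
      then have "scale_op \<i> G (x, p) = Some (\<i> *\<^sub>C (J \<cdot> p), (S \<cdot> q) - \<i> *\<^sub>C (R \<cdot> p))"
        using True dom
        by (simp add: scale_op_def scaleC_prod_def scaleC_diff_right scaleC_minus_right
            scaleC_scaleC scaleC_minus_left del: domIff)
      moreover have "U_op J A (\<i> *\<^sub>C (J \<cdot> p), (S \<cdot> q) - \<i> *\<^sub>C (R \<cdot> p))
          = ((- \<i>) *\<^sub>C (R \<cdot> p) + S \<cdot> q, S \<cdot> p)"
        using True by (simp add: U_op_def W(2) W_J scaleC_scaleC scaleC_minus_left del: domIff)
      ultimately show ?thesis
        using True by (simp add: Pair inv Q_op_def map_comp_def del: domIff)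
    next
      case False
      then have "scale_op \<i> G (x, p) = None" using dom by (simp add: scale_op_def del: domIff)
      then show ?thesis using False by (simp add: Pair inv Q_op_def map_comp_def del: domIff)
    qed
  qed
qed

lemma linear_op_G: "linear_op G"
proof -
  have R: "f \<in> dom A \<Longrightarrow> f \<in> dom R" for f using dom_A_R by blast
  have add: "z + w \<in> dom G \<and> G \<cdot> (z + w) = G \<cdot> z + G \<cdot> w" if zw: "z \<in> dom G" "w \<in> dom G" for z w
  proof -
    obtain x p y q where z: "z = (x, p)" "w = (y, q)" by (cases z, cases w) blast
    have d: "W x \<in> dom A" "p \<in> dom A" "W y \<in> dom A" "q \<in> dom A" using zw by (simp_all add: z dom_G del: domIff)
    have d': "W (x + y) \<in> dom A" "p + q \<in> dom A"
      using d linear_op_add[OF lin] by (simp_all add: linear_add[OF W(1)] del: domIff)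
    have "S \<cdot> W (x + y) = S \<cdot> W x + S \<cdot> W y" "J \<cdot> (p + q) = J \<cdot> p + J \<cdot> q" "R \<cdot> (p + q) = R \<cdot> p + R \<cdot> q"
      using d linear_op_add[OF S.lin] linear_op_add[OF lin_J] linear_op_add[OF lin_R] R
      by (simp_all add: linear_add[OF W(1)] del: domIff)
    then show ?thesis using d d' by (simp add: z dom_G app_G del: domIff)
  qed
  have scale: "c *\<^sub>C z \<in> dom G \<and> G \<cdot> (c *\<^sub>C z) = c *\<^sub>C (G \<cdot> z)" if z': "z \<in> dom G" for z c
  proof -
    obtain x p where z: "z = (x, p)" by (cases z)
    have d: "W x \<in> dom A" "p \<in> dom A" using z' by (simp_all add: z dom_G del: domIff)
    have d': "W (c *\<^sub>C x) \<in> dom A" "c *\<^sub>C p \<in> dom A"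
      using d linear_op_scaleC[OF lin] by (simp_all add: W(2) del: domIff)
    have "S \<cdot> W (c *\<^sub>C x) = c *\<^sub>C (S \<cdot> W x)" "J \<cdot> (c *\<^sub>C p) = c *\<^sub>C (J \<cdot> p)" "R \<cdot> (c *\<^sub>C p) = c *\<^sub>C (R \<cdot> p)"
      using d linear_op_scaleC[OF S.lin] linear_op_scaleC[OF lin_J] linear_op_scaleC[OF lin_R] R
      by (simp_all add: W(2) del: domIff)
    then show ?thesis using d d'
      by (simp add: z dom_G app_G scaleC_prod_def scaleC_diff_right scaleC_minus_right del: domIff)
  qed
  have "0 \<in> dom G" using linear_op_0[OF lin] by (simp add: zero_prod_def dom_G del: domIff)
  then show ?thesis unfolding linear_op_def using add scale by blast
qed

lemma densely_defined_G: "densely_defined G"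
proof -
  have "closure {x. W x \<in> dom A} = UNIV"
  proof (rule closure_eq_UNIV_if_no_orthogonal)
    show "subspace {x. W x \<in> dom A}"
      using linear_subspace_vimage[OF W(1) subspace_dom[OF lin]] by (simp add: vimage_def del: domIff)
    fix y assume y: "\<And>v. v \<in> {x. W x \<in> dom A} \<Longrightarrow> inner y v = 0"
    have "W y = 0"
    proof (rule orthogonal_dense_imp_zero[of "dom A"])
      show "closure (dom A) = UNIV" using dense by (simp add: densely_defined_def)
      fix s assume s: "s \<in> dom A"
      obtain x where x: "W x = s" by (rule W_surj)
      then show "inner (W y) s = 0" using y[of x] W(3)[of y x] s by (simp del: domIff)
    qed
    then show "y = 0" using W_inj[of y 0] by simp
  qed
  moreover have "dom G = {x. W x \<in> dom A} \<times> dom A"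
  proof (rule set_eqI)
    show "z \<in> dom G \<longleftrightarrow> z \<in> {x. W x \<in> dom A} \<times> dom A" for z
      by (cases z) (simp add: dom_G del: domIff)
  qed
  ultimately show ?thesis
    using dense by (simp add: densely_defined_def closure_Times)
qed

text \<open>The convergence \<open>R p\<^sub>n \<rightarrow> R p\<close> is only needed weakly on the dense set \<open>dom |A|\<close>, where it
  follows from \<open>dom |A| \<subseteq> dom R\<^sup>*\<close>.\<close>

lemma closed_op_G: "closed_op G"
  unfolding closed_op_iff
proof (intro allI impI)
  fix u z w assume *: "\<forall>n. u n \<in> dom G" "u \<longlonglongrightarrow> z" "(\<lambda>n. G \<cdot> u n) \<longlonglongrightarrow> w"
  obtain x p where z: "z = (x, p)" by (cases z)
  obtain y v where w: "w = (y, v)" by (cases w)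
  define a where "a n = fst (u n)" for n
  define b where "b n = snd (u n)" for n
  have u: "u n = (a n, b n)" for n by (simp add: a_def b_def)
  have d: "W (a n) \<in> dom A" "b n \<in> dom A" for n using *(1) by (simp_all add: u dom_G del: domIff)
  have Gu: "G \<cdot> u n = (J \<cdot> b n, - (S \<cdot> W (a n)) - R \<cdot> b n)" for n
    unfolding u using d by (rule app_G)
  have a: "a \<longlonglongrightarrow> x" and b: "b \<longlonglongrightarrow> p"
    using tendsto_fst[OF *(2)] tendsto_snd[OF *(2)] by (simp_all add: u z)
  have Jb: "(\<lambda>n. J \<cdot> b n) \<longlonglongrightarrow> y" and SR: "(\<lambda>n. - (S \<cdot> W (a n)) - R \<cdot> b n) \<longlonglongrightarrow> v"
    using tendsto_fst[OF *(3)] tendsto_snd[OF *(3)] by (simp_all add: Gu w)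
  have W_lim: "(\<lambda>n. W (f n)) \<longlonglongrightarrow> W l" if "f \<longlonglongrightarrow> l" for f l
    using that continuous_on_linear_contraction[OF W(1)] W(4)
    by (auto intro: continuous_on_tendsto_compose[of UNIV W])
  \<comment> \<open>W J = S on \<open>dom A\<close>, so the first component of G u_n controls S b_n,
    and closedness of S identifies the limit p.\<close>
  have "(\<lambda>n. S \<cdot> b n) \<longlonglongrightarrow> W y" using W_lim[OF Jb] d by (simp add: W_J del: domIff)
  then have p: "p \<in> dom A" "S \<cdot> p = W y"
    using closed_opD[OF S.closed _ b] d(2) by (simp_all del: domIff)
  have "J \<cdot> p = y" using p by (metis W_J W_inj)
  have "adj S (W x) = Some (- v - R \<cdot> p)"
    unfolding adj_eq_Some_iff[OF S.lin S.dense]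
  proof
    fix h assume "h \<in> dom S"
    then have h: "h \<in> dom A" "h \<in> dom (adj R)" using dom_A_R by auto
    have R: "inner (R \<cdot> f) h = inner f (adj R \<cdot> h)" if "f \<in> dom A" for f
      using inner_adj[OF lin_R dense_R h(2), of f] dom_A_R that by (auto simp: inner_commute)
    have "(\<lambda>n. inner (W (a n)) (S \<cdot> h)) \<longlonglongrightarrow> inner (W x) (S \<cdot> h)"
      by (intro tendsto_intros W_lim a)
    \<comment> \<open>The second component of G u_n is paired with h and solved for (W a_n, S h),
      with R moved onto h as its adjoint.\<close>
    moreover have "(\<lambda>n. - inner (- (S \<cdot> W (a n)) - R \<cdot> b n) h - inner (b n) (adj R \<cdot> h))
        \<longlonglongrightarrow> - inner v h - inner p (adj R \<cdot> h)"
      by (intro tendsto_intros SR b)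
    moreover have "- inner (- (S \<cdot> W (a n)) - R \<cdot> b n) h - inner (b n) (adj R \<cdot> h)
        = inner (W (a n)) (S \<cdot> h)" for n
      using S.S_sym[of "W (a n)" h] d h R[of "b n"] by (simp add: inner_diff_left del: domIff)
    ultimately have "inner (W x) (S \<cdot> h) = - inner v h - inner p (adj R \<cdot> h)"
      by (auto intro: LIMSEQ_unique)
    then show "inner (W x) (S \<cdot> h) = inner (- v - R \<cdot> p) h"
      using R[OF p(1)] by (simp add: inner_diff_left)
  qed
  then have "S (W x) = Some (- v - R \<cdot> p)" by simp
  then have x: "W x \<in> dom A" "S \<cdot> W x = - v - R \<cdot> p" using S_SomeD by blast+
  show "z \<in> dom G \<and> G \<cdot> z = w"
    using x p \<open>J \<cdot> p = y\<close> by (simp add: z w dom_G app_G del: domIff)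
qed

text \<open>The off-diagonal terms cancel: (x, J p) = (W x, S p) = (p, S W x) in the real inner
  product. Only the damping remains.\<close>

lemma inner_G:
  assumes "z \<in> dom G"
  shows "inner z (G \<cdot> z) = - inner (snd z) (R \<cdot> snd z)"
proof -
  obtain x p where z: "z = (x, p)" by (cases z)
  have d: "W x \<in> dom A" "p \<in> dom A" using assms by (simp_all add: z dom_G del: domIff)
  have "inner x (J \<cdot> p) = inner (W x) (S \<cdot> p)" using W(3)[of x "J \<cdot> p"] d by (simp add: W_J del: domIff)
  also have "\<dots> = inner p (S \<cdot> W x)"
    using S.S_sym[of "W x" p] d by (simp add: inner_commute del: domIff)
  finally show ?thesis using d by (simp add: z app_G inner_diff_right del: domIff)
qed

end

section \<open>Accretive damping: range condition, semigroup and the quadratic pencil\<close>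

locale accretively_damped_wave = damped_wave A R J
  for A :: "'a::chilbert_space \<rightharpoonup> 'b::chilbert_space" and R :: "'a \<rightharpoonup> 'a"
    and J :: "'a \<rightharpoonup> 'h::chilbert_space" +
  assumes accretive_R: "accretive R"
begin

lemma inner_R: "f \<in> dom A \<Longrightarrow> 0 \<le> inner f (R \<cdot> f)"
  using accretive_R dom_A_R by (auto simp: accretive_def Re_cinner subset_iff)

lemma inner_G_le: "z \<in> dom G \<Longrightarrow> inner z (G \<cdot> z) \<le> 0"
  using inner_G[of z] inner_R[of "snd z"] by (cases z) (simp add: dom_G del: domIff)

lemma accretive_minus_G: "accretive (scale_op (- 1) G)"
proof -
  have d: "dom (scale_op (- 1) G) = dom G"
    by (auto simp: scale_op_def dom_def)
  show ?thesis
    unfolding accretive_def d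
    using inner_G_le by (simp add: scale_op_def Re_cinner scaleC_minus_left del: domIff)
qed

lemma one_minus_G_orthogonal:
  assumes h: "h > 0" and orth: "\<And>z. z \<in> dom G \<Longrightarrow> inner y (z - h *\<^sub>R (G \<cdot> z)) = 0"
  shows "y = 0"
proof -
  obtain y1 y2 where y: "y = (y1, y2)" by (cases y)
  have S0: "S \<cdot> 0 = 0" and J0: "J \<cdot> 0 = 0" and R0: "R \<cdot> 0 = 0" and A0: "0 \<in> dom A"
    using linear_op_0[OF S.lin] linear_op_0[OF lin_J] linear_op_0[OF lin_R] linear_op_0[OF lin] by auto
  \<comment> \<open>Testing against (x, 0) with W x = s bounds the functional s -> (y2, S s);
    self-adjointness of S then puts y2 in its domain and computes S y2.\<close>
  have "adj S y2 = Some ((- (1 / h)) *\<^sub>R W y1)"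
    unfolding adj_eq_Some_iff[OF S.lin S.dense]
  proof
    fix s assume s: "s \<in> dom S"
    obtain x where x: "W x = s" by (rule W_surj)
    have "(x, 0) \<in> dom G" using s A0 by (simp add: dom_G x del: domIff)
    moreover have "G \<cdot> (x, 0) = (0, - (S \<cdot> s))"
      using s A0 by (simp add: app_G x J0 R0 del: domIff)
    ultimately have "inner y1 x + h * inner y2 (S \<cdot> s) = 0"
      using orth[of "(x, 0)"] by (simp add: y)
    then have "inner y2 (S \<cdot> s) = - (1 / h) * inner y1 x" using h by (simp add: field_simps)
    then show "inner y2 (S \<cdot> s) = inner ((- (1 / h)) *\<^sub>R W y1) s"
      using W(3)[of y1 x] by (simp add: x)
  qed
  then have "S y2 = Some ((- (1 / h)) *\<^sub>R W y1)" by simp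
  then have y2: "y2 \<in> dom A" "S \<cdot> y2 = (- (1 / h)) *\<^sub>R W y1" using S_SomeD by blast+
  have "(0, y2) \<in> dom G" using y2 A0 by (simp add: dom_G del: domIff)
  moreover have "G \<cdot> (0, y2) = (J \<cdot> y2, - (R \<cdot> y2))"
    using y2 A0 by (simp add: app_G S0 del: domIff)
  ultimately have e: "- h * inner y1 (J \<cdot> y2) + inner y2 y2 + h * inner y2 (R \<cdot> y2) = 0"
    using orth[of "(0, y2)"] by (simp add: y inner_diff_right algebra_simps)
  \<comment> \<open>With the value of S y2 the cross term -h (y1, J y2) becomes |y1|^2, leaving a
    vanishing sum of three nonnegative terms.\<close>
  have "inner y1 (J \<cdot> y2) = inner (W y1) (S \<cdot> y2)"
    using W(3)[of y1 "J \<cdot> y2"] y2 by (simp add: W_J del: domIff)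
  also have "\<dots> = - (1 / h) * inner y1 y1" using W(3)[of y1 y1] by (simp add: y2)
  finally have "inner y1 y1 + inner y2 y2 + h * inner y2 (R \<cdot> y2) = 0" using e h by simp
  moreover have "0 \<le> h * inner y2 (R \<cdot> y2)" using inner_R[of y2] y2 h by (simp del: domIff)
  ultimately have "inner y1 y1 = 0" "inner y2 y2 = 0"
    using inner_ge_zero[of y1] inner_ge_zero[of y2] by linarith+
  then show ?thesis by (simp add: y zero_prod_def)
qed

lemma one_minus_G_surj:
  assumes h: "h > 0"
  shows "\<exists>z\<in>dom G. z - h *\<^sub>R (G \<cdot> z) = y"
proof -
  let ?V = "(\<lambda>z. z - h *\<^sub>R (G \<cdot> z)) ` dom G"
  have V: "subspace ?V"
  proof (rule subspaceI)
    show "0 \<in> ?V" using linear_op_0[OF linear_op_G] by (intro image_eqI[of _ _ 0]) simp_all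
    show "a + b \<in> ?V" if ab: "a \<in> ?V" "b \<in> ?V" for a b
    proof -
      obtain z w where zw: "z \<in> dom G" "a = z - h *\<^sub>R (G \<cdot> z)" "w \<in> dom G" "b = w - h *\<^sub>R (G \<cdot> w)"
        using ab by blast
      show ?thesis using linear_op_add[OF linear_op_G zw(1,3)]
        by (intro image_eqI[of _ _ "z + w"]) (simp_all add: zw(2,4) algebra_simps)
    qed
    show "c *\<^sub>R a \<in> ?V" if a: "a \<in> ?V" for a c
    proof -
      obtain z where z: "z \<in> dom G" "a = z - h *\<^sub>R (G \<cdot> z)" using a by blast
      show ?thesis using linear_op_scaleR[OF linear_op_G z(1), of c]
        by (intro image_eqI[of _ _ "c *\<^sub>R z"]) (simp_all add: z(2) algebra_simps)
    qed
  qed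
  have "closure ?V = UNIV"
    using one_minus_G_orthogonal[OF h] by (intro closure_eq_UNIV_if_no_orthogonal[OF V]) blast
  then obtain w where w: "\<And>n. w n \<in> ?V" "w \<longlonglongrightarrow> y" using closure_sequential[of y ?V] by auto
  have "\<exists>z. z \<in> dom G \<and> z - h *\<^sub>R (G \<cdot> z) = w n" for n
    using w(1)[of n] by (metis (no_types, lifting) imageE)
  then obtain u where u: "\<And>n. u n \<in> dom G" "\<And>n. u n - h *\<^sub>R (G \<cdot> u n) = w n" by metis
  have le: "dist (u m) (u n) \<le> dist (w m) (w n)" for m n
  proof -
    have d: "u m - u n \<in> dom G" "G \<cdot> (u m - u n) = G \<cdot> u m - G \<cdot> u n"
      using linear_op_diff[OF linear_op_G u(1) u(1)] by blast+
    have "w m - w n = (u m - u n) - h *\<^sub>R (G \<cdot> (u m - u n))"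
      unfolding d(2) u(2)[symmetric] by (simp add: algebra_simps)
    then show ?thesis using norm_le_norm_diff_dissipative[OF h inner_G_le[OF d(1)]] by (simp add: dist_norm)
  qed
  have "Cauchy u"
    using LIMSEQ_imp_Cauchy[OF w(2)] unfolding Cauchy_def by (meson le le_less_trans)
  then obtain z where z: "u \<longlonglongrightarrow> z" using Cauchy_convergent convergent_def by blast
  \<comment> \<open>The equation solved by u_n expresses G u_n through convergent sequences, so
    closedness of G applies.\<close>
  have "G \<cdot> u n = (1 / h) *\<^sub>R (u n - w n)" for n using h by (simp flip: u(2)[of n])
  then have "(\<lambda>n. G \<cdot> u n) \<longlonglongrightarrow> (1 / h) *\<^sub>R (z - y)" by (simp only:) (intro tendsto_intros z w)
  then have "z \<in> dom G \<and> G \<cdot> z = (1 / h) *\<^sub>R (z - y)" using closed_opD[OF closed_op_G u(1) z] by blast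
  then show ?thesis using h by (intro bexI[of _ z]) simp_all
qed

sublocale G: m_dissipative "G_op J A R"
  by unfold_locales (simp_all add: linear_op_G densely_defined_G inner_G_le one_minus_G_surj del: domIff)

text \<open>With \<open>z = \<i>\<close>, \<open>M(z) = |A|\<^sup>2 + R + 1\<close> is the Schur complement of \<open>1 - G\<close>.\<close>

lemma i_in_rho_M: "\<i> \<in> rho_M A R"
proof -
  \<comment> \<open>Solve (1 - G) (x, p) = (0, v). The first component gives x = J p, hence W x = S
    p; the second becomes S (S p) + R p + p = v. So p is the required solution.\<close>
  define B' where "B' v = snd (G.K 1 (0, v))" for v
  have M: "M_op A R \<i> f = (if f \<in> dom A \<and> S \<cdot> f \<in> dom A then Some (S \<cdot> (S \<cdot> f) + R \<cdot> f + f) else None)" for f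
    using dom_map_comp_iff[of f S S] app_map_comp[of f S S]
    by (simp add: M_op_def scaleC_minus_left del: domIff)
  have dom_M: "f \<in> dom (M_op A R \<i>) \<longleftrightarrow> f \<in> dom A \<and> S \<cdot> f \<in> dom A" for f
    unfolding domIff[of f "M_op A R \<i>"] M by simp
  have "clinear_map B'"
  proof -
    have "G.K 1 (0, x + y) = G.K 1 (0, x) + G.K 1 (0, y)" for x y
      using G.K_add[of 1 "(0, x)" "(0, y)"] by simp
    moreover have "G.K 1 (0, c *\<^sub>C x) = c *\<^sub>C G.K 1 (0, x)" for c x
      using G.K_scaleC[of 1 c "(0, x)"] by (simp add: scaleC_prod_def)
    ultimately show ?thesis by (simp add: clinear_map_def B'_def scaleC_prod_def)
  qed
  moreover have "norm (B' v) \<le> 1 * norm v" for v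
    using G.norm_K[of 1 "(0, v)"] norm_snd_le[of "snd (G.K 1 (0, v))" "fst (G.K 1 (0, v))"]
    by (simp add: B'_def norm_Pair)
  moreover have "B' v \<in> dom (M_op A R \<i>) \<and> M_op A R \<i> \<cdot> B' v - 0 *\<^sub>C B' v = v" for v
  proof -
    obtain x p where xp: "G.K 1 (0, v) = (x, p)" by (cases "G.K 1 (0, v)")
    have d: "W x \<in> dom A" "p \<in> dom A"
      using G.K(1)[of 1 "(0, v)"] by (simp_all add: xp dom_G del: domIff)
    have eq: "(x, p) - G \<cdot> (x, p) = (0, v)" using G.K(2)[of 1 "(0, v)"] by (simp add: xp)
    have e: "x = J \<cdot> p" using arg_cong[OF eq, of fst] unfolding app_G[OF d] by simp
    have "p - (- (S \<cdot> W x) - R \<cdot> p) = v" using arg_cong[OF eq, of snd] unfolding app_G[OF d] by simp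
    then have v: "p + S \<cdot> W x + R \<cdot> p = v" by (simp only: diff_diff_eq2 diff_minus_eq_add) (simp add: ac_simps)
    have Wx: "W x = S \<cdot> p" unfolding e by (rule W_J[OF d(2)])
    have "0 *\<^sub>C p = 0" using scaleC_of_real[of 0 p] by simp
    then show ?thesis using d v by (simp add: B'_def xp dom_M M Wx ac_simps del: domIff)
  qed
  moreover have "B' (M_op A R \<i> \<cdot> f - 0 *\<^sub>C f) = f" if "f \<in> dom (M_op A R \<i>)" for f
  proof -
    have d: "f \<in> dom A" "S \<cdot> f \<in> dom A" using that dom_M by blast+
    have G: "(J \<cdot> f, f) \<in> dom G" "G \<cdot> (J \<cdot> f, f) = (J \<cdot> f, - (S \<cdot> (S \<cdot> f)) - R \<cdot> f)"
      using d by (simp_all add: dom_G app_G W_J del: domIff)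
    \<comment> \<open>Conversely, every f in the domain of M(i) lifts to (J f, f), which 1 - G sends
      to (0, M(i) f); injectivity of 1 - G recovers f.\<close>
    have "(J \<cdot> f, f) - 1 *\<^sub>R (G \<cdot> (J \<cdot> f, f)) = (0, M_op A R \<i> \<cdot> f)"
      unfolding G(2) M using d by (simp add: algebra_simps del: domIff)
    then have "G.K 1 (0, M_op A R \<i> \<cdot> f) = (J \<cdot> f, f)" using G.K_unique[OF zero_less_one G(1)] by simp
    moreover have "0 *\<^sub>C f = 0" using scaleC_of_real[of 0 f] by simp
    ultimately show ?thesis by (simp add: B'_def)
  qed
  ultimately have "0 \<in> resolvent_set (M_op A R \<i>)" unfolding resolvent_set_def by blast
  then show ?thesis by (simp add: rho_M_def)
qed

end

theorem theorem5p6: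
  fixes A :: "'a::chilbert_space \<rightharpoonup> 'b::chilbert_space"
    and R :: "'a \<rightharpoonup> 'a"
    and J :: "'a \<rightharpoonup> 'h::chilbert_space"
  assumes "separable_space (euclidean :: 'a topology)"
    and "separable_space (euclidean :: 'b topology)"
    and "linear_op A" and "densely_defined A" and "closed_op A"
    and "ker_op A = {0}"
    and "(INF z\<in>spectrum (adj A \<circ>\<^sub>m A). ereal (Re z)) = 0"
    and "linear_op R" and "densely_defined R" and "closable_op R"
    and "dom A \<subseteq> dom R \<inter> dom (adj R)"
    and "is_completion A J"
  shows "Q_op A R = (Some \<circ> U_op J A) \<circ>\<^sub>m scale_op \<i> (G_op J A R) \<circ>\<^sub>m (Some \<circ> inv (U_op J A))
    \<and> densely_defined (G_op J A R) \<and> closed_op (G_op J A R)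
    \<and> (accretive R \<longrightarrow>
         (\<exists>l::real. l > 0 \<and> \<i> * complex_of_real l \<in> rho_M A R)
         \<and> accretive (scale_op (- 1) (G_op J (abs_op A) R))
         \<and> generates_contraction_semigroup (G_op J (abs_op A) R))"
proof -
  interpret damped_wave A R J using assms by unfold_locales
  have "(\<exists>l::real. l > 0 \<and> \<i> * complex_of_real l \<in> rho_M A R)
      \<and> accretive (scale_op (- 1) G) \<and> generates_contraction_semigroup G" if "accretive R"
  proof -
    interpret accretively_damped_wave A R J using that by unfold_locales
    show ?thesis
      \<comment> \<open>The witness is lambda = 1, coming from the resolvent with step h =
        1.\<close>
      using i_in_rho_M accretive_minus_G G.generates by (intro conjI exI[of _ 1]) simp_all
  qed
  then show ?thesis unfolding G_abs_op using Q_eq densely_defined_G closed_op_G by blast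
qed

end
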